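(* Every $n$-qubit Clifford unitary can be implemented (up to global phase) by a circuit on $n$ qubits consisting of local Clifford gates and at most $6n-8$ targeted $\mathrm{GMS}$ gates.
   Context: For a set $S$ of qubits and a real $\alpha$, the (targeted) global Mølmer-Sørensen gate is $\mathrm{GMS}_S(\alpha)=\exp\bigl(-i\frac{\alpha}{4}\sum_{i\neq j\in S}X_iX_j\bigr)$, where the sum is over ordered pairs of distinct elements of $S$ and $X_i$ is the Pauli $X$ on qubit $i$; equivalently $\mathrm{GMS}_S(\alpha)=\prod_{i<j\in S}\exp(-i\frac{\alpha}{2}X_iX_j)$. "Targeted" means that each $\mathrm{GMS}$ gate in the circuit may be applied to any subset $S$ of the $n$ qubits (with any angle $\alpha$), where the subset may differ from gate to gate. An $n$-qubit Clifford unitary is a unitary on $(\mathbb{C}^2)^{\otimes n}$ that (up to global phase) is a product of Hadamard gates, $S=\mathrm{diag}(1,i)$ gates and CNOT gates. A local Clifford gate is a single-qubit Clifford unitary; any number of these may be used.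
   Formalization: The formal theorem assumes n ≥ 2; for n = 1 the bound 6n−8 equals −2, so the claim as stated is false there (no circuit has a negative number of GMS gates). *)

theory Defs
  imports "HOL-Analysis.Analysis"
begin

text \<open>
  The qubits are the elements of a finite type \<open>'q\<close>, so \<open>n = CARD('q)\<close>.  A computational basis
  state assigns a bit to each qubit; an operator on the \<open>n\<close>-qubit space is the matrix of its
  coefficients in this basis, with entry \<open>U $ x $ y = <x|U|y>\<close>.
\<close>

type_synonym 'b cmat = "complex ^ 'b ^ 'b"
type_synonym 'q qop = "('q \<Rightarrow> bool) cmat"
type_synonym qop1 = "bool cmat"

definition cscale :: "complex \<Rightarrow> 'b::finite cmat \<Rightarrow> 'b cmat" where
  "cscale c A = (\<chi> x y. c * A $ x $ y)"

definition eq_up_to_phase :: "'b::finite cmat \<Rightarrow> 'b cmat \<Rightarrow> bool" where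
  "eq_up_to_phase U V \<longleftrightarrow> (\<exists>c. cmod c = 1 \<and> U = cscale c V)"

definition cmat_exp :: "'b::finite cmat \<Rightarrow> 'b cmat" where
  "cmat_exp A = (\<Sum>k. (1 / fact k) *\<^sub>R (((**) A ^^ k) (mat 1)))"

definition cmat_prod :: "'b::finite cmat list \<Rightarrow> 'b cmat" where
  "cmat_prod As = foldr (**) As (mat 1)"

definition pauli_X :: qop1 where
  "pauli_X = (\<chi> a b. if a \<noteq> b then 1 else 0)"

definition hadamard :: qop1 where
  "hadamard = (\<chi> a b. (if a \<and> b then - 1 else 1) / complex_of_real (sqrt 2))"

definition phase_S :: qop1 where
  "phase_S = (\<chi> a b. if a = b then (if a then \<i> else 1) else 0)"

text \<open>The tensor product of \<open>M\<close> on qubit \<open>q\<close> with the identity on all other qubits.\<close>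

definition on_qubit :: "'q::finite \<Rightarrow> qop1 \<Rightarrow> 'q qop" where
  "on_qubit q M = (\<chi> x y. if \<forall>p. p \<noteq> q \<longrightarrow> x p = y p then M $ x q $ y q else 0)"

text \<open>Control \<open>p\<close>, target \<open>q\<close>; used only for \<open>p \<noteq> q\<close>.\<close>

definition cnot :: "'q::finite \<Rightarrow> 'q \<Rightarrow> 'q qop" where
  "cnot p q = (\<chi> x y. if x = y(q := (y q \<noteq> y p)) then 1 else 0)"

text \<open>
  Unitarity is not listed separately in the two Clifford predicates: the generators are unitary
  and the phase has modulus one.
\<close>

definition clifford_gates :: "'q::finite qop set" where
  "clifford_gates =
     {on_qubit q hadamard | q. True} \<union> {on_qubit q phase_S | q. True} \<union> {cnot p q | p q. p \<noteq> q}"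

definition clifford :: "'q::finite qop \<Rightarrow> bool" where
  "clifford U \<longleftrightarrow> (\<exists>gs. set gs \<subseteq> clifford_gates \<and> eq_up_to_phase U (cmat_prod gs))"

definition clifford1 :: "qop1 \<Rightarrow> bool" where
  "clifford1 M \<longleftrightarrow> (\<exists>gs. set gs \<subseteq> {hadamard, phase_S} \<and> eq_up_to_phase M (cmat_prod gs))"

definition gms :: "'q::finite set \<Rightarrow> real \<Rightarrow> 'q qop" where
  "gms S \<alpha> = cmat_exp (cscale (- \<i> * complex_of_real \<alpha> / 4)
     (\<Sum>(i, j) \<in> {(i, j). i \<in> S \<and> j \<in> S \<and> i \<noteq> j}. on_qubit i pauli_X ** on_qubit j pauli_X))"

datatype 'q gate = Local 'q qop1 | GMS "'q set" real

primrec gate_op :: "'q::finite gate \<Rightarrow> 'q qop" where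
  "gate_op (Local q M) = on_qubit q M"
| "gate_op (GMS S \<alpha>) = gms S \<alpha>"

primrec admissible_gate :: "'q gate \<Rightarrow> bool" where
  "admissible_gate (Local q M) \<longleftrightarrow> clifford1 M"
| "admissible_gate (GMS S \<alpha>) \<longleftrightarrow> True"

primrec is_GMS :: "'q gate \<Rightarrow> bool" where
  "is_GMS (Local q M) \<longleftrightarrow> False"
| "is_GMS (GMS S \<alpha>) \<longleftrightarrow> True"

text \<open>The head of the list is the gate applied first, hence the rightmost factor.\<close>

definition circuit_op :: "'q::finite gate list \<Rightarrow> 'q qop" where
  "circuit_op C = cmat_prod (rev (map gate_op C))"

definition gms_count :: "'q gate list \<Rightarrow> nat" where
  "gms_count C = length (filter is_GMS C)"

end

theory Submission imports Defs begin

text \<open>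
  Conjugated by Hadamard gates, a \<open>GMS\<close> gate of angle \<open>\<plusminus> \<pi> / 2\<close> on \<open>S\<close> is diagonal, and its eigenvalue at
  a basis state with \<open>w\<close> ones in \<open>S\<close> depends, up to powers \<open>k ^ w\<close> of a fourth root of unity, only
  on the parity of \<open>w\<close>. So the gate equals, up to local Clifford gates, the rotation
  \<open>(1 \<plusminus> \<i> P) / sqrt 2\<close> for the product \<open>P\<close> of the \<open>X\<close> on \<open>S\<close>; conjugating by local Clifford gates, every
  Pauli string \<open>P\<close> occurs. Such a rotation acts on Pauli strings as the symplectic transvection along
  \<open>P\<close>, and two Pauli strings that anticommute are exchanged by the transvection along their product.

  For a Clifford unitary \<open>U\<close> and a qubit \<open>q\<close>, two transvections move the image of \<open>X\<^sub>q\<close> back to \<open>X\<^sub>q\<close> and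
  two more move the image of \<open>Z\<^sub>q\<close> back to \<open>Z\<^sub>q\<close> while fixing \<open>X\<^sub>q\<close>; Pauli gates repair the signs. This
  splits off one qubit at the cost of four \<open>GMS\<close> gates, and the last qubit only needs local gates.
  The total \<open>4 (n - 1)\<close> is at most \<open>6 n - 8\<close> for \<open>n \<ge> 2\<close>.
\<close>

section \<open>Pauli strings\<close>

lemma cscale_nth [simp]: "cscale c A $ u $ v = c * A $ u $ v"
  by (simp add: cscale_def)

lemma cscale_mult_left [simp]: "cscale c A ** B = cscale c (A ** B)"
  by (simp add: vec_eq_iff matrix_matrix_mult_def sum_distrib_left mult.assoc)

lemma cscale_mult_right [simp]: "A ** cscale c B = cscale c (A ** B)"
  by (simp add: vec_eq_iff matrix_matrix_mult_def sum_distrib_left mult.left_commute)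

lemma cscale_cscale [simp]: "cscale c (cscale d A) = cscale (c * d) A"
  by (simp add: vec_eq_iff mult.assoc)

lemma cscale_one [simp]: "cscale 1 A = A"
  by (simp add: vec_eq_iff)

lemma cscale_add: "cscale c (A + B) = cscale c A + cscale c B"
  by (simp add: vec_eq_iff distrib_left)

lemma matrix_add_rdistrib: "(A + B) ** C = A ** C + B ** (C :: 'b::finite cmat)"
  by (simp add: vec_eq_iff matrix_matrix_mult_def distrib_right sum.distrib)

lemma det_cscale: "det (cscale c A) = c ^ CARD('b) * det (A :: 'b::finite cmat)"
proof -
  have "cscale c A = cscale c (mat 1) ** A" by simp
  moreover have "det (cscale c (mat 1) :: 'b cmat) = c ^ CARD('b)"
    by (subst det_diagonal) (auto simp: mat_def)
  ultimately show ?thesis by (metis det_mul)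
qed

text \<open>Keeps track of the modulus of the phase without unitarity: a scalar matrix with this property is a phase.\<close>

definition unit_det :: "'b::finite cmat \<Rightarrow> bool" where
  "unit_det A \<longleftrightarrow> cmod (det A) = 1"

lemma unit_det_mult: "unit_det A \<Longrightarrow> unit_det B \<Longrightarrow> unit_det (A ** B)"
  by (simp add: unit_det_def det_mul norm_mult)

lemma unit_det_mat_1: "unit_det (mat 1)"
  by (simp add: unit_det_def)

lemma unit_det_cscale: "cmod c = 1 \<Longrightarrow> unit_det A \<Longrightarrow> unit_det (cscale c A)"
  by (simp add: unit_det_def det_cscale norm_mult norm_power)

text \<open>Generators, Pauli strings and rotations all have a fourth power that is a scalar of
  modulus one, so no determinant ever has to be computed.\<close>

lemma unit_det_of_power:
  assumes "(A ** A) ** (A ** A) = cscale c (mat 1)" "cmod c = 1"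
  shows "unit_det A"
proof -
  have "cmod (det ((A ** A) ** (A ** A))) = 1"
    using assms unit_det_cscale unit_det_mat_1 unfolding unit_det_def by metis
  then have "cmod (det A) ^ 4 = 1"
    by (simp add: det_mul norm_mult power4_eq_xxxx)
  then show ?thesis unfolding unit_det_def
    using power_eq_imp_eq_base[of "cmod (det A)" 4 1] by simp
qed

lemma unit_det_cancel:
  assumes "unit_det U" "A ** U = B ** U"
  shows "A = B"
proof -
  have "det U \<noteq> 0" using assms(1) by (auto simp: unit_det_def)
  then obtain V where "U ** V = mat 1" using invertible_det_nz[of U] by (auto simp: invertible_def)
  then show ?thesis using assms(2) by (metis matrix_mul_assoc matrix_mul_rid)
qed

section \<open>Bit strings under exclusive or, and their sign characters\<close>

definition bxor :: "('q \<Rightarrow> bool) \<Rightarrow> ('q \<Rightarrow> bool) \<Rightarrow> 'q \<Rightarrow> bool" (infixl "\<oplus>" 65) where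
  "x \<oplus> y = (\<lambda>j. x j \<noteq> y j)"

definition single :: "'q \<Rightarrow> 'q \<Rightarrow> bool" where
  "single q = (\<lambda>j. j = q)"

lemma single_apply: "single q j \<longleftrightarrow> j = q"
  by (simp add: single_def)

abbreviation none :: "'q \<Rightarrow> bool" where
  "none \<equiv> (\<lambda>_. False)"

lemma bxor_cancel [simp]: "x \<oplus> y \<oplus> y = x"
  by (auto simp: bxor_def)

lemma bxor_none [simp]: "x \<oplus> none = x" "none \<oplus> x = x"
  by (auto simp: bxor_def)

lemma bxor_self [simp]: "x \<oplus> x = none"
  by (auto simp: bxor_def)

lemma bxor_comm: "x \<oplus> y = y \<oplus> x"
  by (auto simp: bxor_def)

lemma bxor_assoc: "x \<oplus> y \<oplus> z = x \<oplus> (y \<oplus> z)"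
  by (auto simp: bxor_def)

lemma bxor_eq_iff: "u = v \<oplus> a \<longleftrightarrow> u \<oplus> a = v"
  by (auto simp: bxor_def)

definition sg :: "bool \<Rightarrow> complex" where
  "sg s = (if s then - 1 else 1)"

lemma sg_simps [simp]: "sg True = - 1" "sg False = 1"
  by (simp_all add: sg_def)

text \<open>The character \<open>(-1)^(a . b)\<close> on the group of bit strings. Written as a
  product of signs, bilinearity modulo 2 becomes multiplicativity in each argument.\<close>

definition chi :: "('q::finite \<Rightarrow> bool) \<Rightarrow> ('q \<Rightarrow> bool) \<Rightarrow> complex" where
  "chi a b = (\<Prod>j\<in>UNIV. sg (a j \<and> b j))"

lemma chi_comm: "chi a b = chi b a"
  by (simp add: chi_def conj_commute)

lemma chi_bxor_right: "chi a (b \<oplus> c) = chi a b * chi a c"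
  by (auto simp: chi_def sg_def bxor_def simp flip: prod.distrib intro!: prod.cong)

lemma chi_bxor_left: "chi (b \<oplus> c) a = chi b a * chi c a"
  by (metis chi_bxor_right chi_comm)

lemma chi_square [simp]: "chi a b * chi a b = 1"
  by (auto simp: chi_def sg_def simp flip: prod.distrib intro!: prod.neutral)

lemma chi_cases: "chi a b = 1 \<or> chi a b = - 1"
  using chi_square[of a b] square_eq_1_iff by blast

lemma chi_none [simp]: "chi a none = 1" "chi none a = 1"
  by (simp_all add: chi_def sg_def)

lemma chi_split: "chi a b = sg (a q \<and> b q) * (\<Prod>j\<in>-{q}. sg (a j \<and> b j))"
  unfolding chi_def by (subst prod.remove[of _ q]) (auto simp: Compl_eq_Diff_UNIV)

lemma chi_single [simp]: "chi (single q) b = sg (b q)" "chi b (single q) = sg (b q)"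
proof -
  show "chi (single q) b = sg (b q)"
    unfolding chi_split[of _ _ q] by (auto simp: single_def sg_def intro!: prod.neutral)
  then show "chi b (single q) = sg (b q)" by (simp add: chi_comm)
qed

text \<open>The product of X on the qubits in \<open>a\<close> and Z on those in \<open>b\<close>,
  with Z acting first. No factor of \<open>\<i>\<close> is inserted, so a qubit in both carries XZ,
  which is Y up to phase, and the square of a string is the sign \<open>chi b a\<close>.\<close>

definition pauli :: "('q::finite \<Rightarrow> bool) \<Rightarrow> ('q \<Rightarrow> bool) \<Rightarrow> 'q qop" where
  "pauli a b = (\<chi> u v. if u = v \<oplus> a then chi b v else 0)"

lemma mult_pauli_nth: "(M ** pauli a b) $ u $ v = M $ u $ (v \<oplus> a) * chi b v"
  by (simp add: matrix_matrix_mult_def pauli_def if_distrib cong: if_cong)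

lemma pauli_mult_nth: "(pauli a b ** M) $ u $ v = chi b (u \<oplus> a) * M $ (u \<oplus> a) $ v"
  by (simp add: matrix_matrix_mult_def pauli_def bxor_eq_iff if_distrib[of "\<lambda>x. x * _"] cong: if_cong)

lemma pauli_none [simp]: "pauli none none = mat 1"
  by (simp add: pauli_def mat_def vec_eq_iff)

lemma pauli_mult: "pauli a b ** pauli a' b' = cscale (chi b a') (pauli (a \<oplus> a') (b \<oplus> b'))"
proof -
  have "(pauli a b ** pauli a' b') $ u $ v = cscale (chi b a') (pauli (a \<oplus> a') (b \<oplus> b')) $ u $ v" for u v
    unfolding mult_pauli_nth
    by (simp add: pauli_def chi_bxor_left chi_bxor_right bxor_assoc bxor_comm[of a a'])
  then show ?thesis by (simp add: vec_eq_iff)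
qed

text \<open>The sign with which two Pauli strings commute, the multiplicative form of the symplectic form.\<close>

definition csign :: "('q::finite \<Rightarrow> bool) \<Rightarrow> ('q \<Rightarrow> bool) \<Rightarrow> ('q \<Rightarrow> bool) \<Rightarrow> ('q \<Rightarrow> bool) \<Rightarrow> complex" where
  "csign a b a' b' = chi b a' * chi b' a"

lemma csign_cases: "csign a b a' b' = 1 \<or> csign a b a' b' = - 1"
  using chi_cases[of b a'] chi_cases[of b' a] by (auto simp: csign_def)

lemma pauli_commute: "pauli a b ** pauli a' b' = cscale (csign a b a' b') (pauli a' b' ** pauli a b)"
  unfolding pauli_mult cscale_cscale csign_def
  by (simp add: mult.assoc bxor_comm)

lemma pauli_square: "pauli a b ** pauli a b = cscale (chi b a) (mat 1)"
  by (simp add: pauli_mult)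

text \<open>The entry of a Pauli string in row \<open>a\<close> and column \<open>none\<close> is 1.
  This turns operator identities into scalar ones.\<close>

lemma pauli_inject_scale:
  assumes "cscale c (pauli a b) = cscale d (pauli a b)"
  shows "c = d"
proof -
  have "cscale c (pauli a b) $ a $ none = cscale d (pauli a b) $ a $ none" using assms by simp
  then show ?thesis by (simp add: pauli_def)
qed

lemma unit_det_pauli: "unit_det (pauli a b)"
  by (rule unit_det_of_power[where c=1]) (simp_all add: pauli_square)

section \<open>Conjugation of Pauli strings\<close>

text \<open>Conjugation by \<open>U\<close> takes one string to a multiple of the other, stated
  without an inverse. Leaving the scalar open separates the symplectic action from the signs, which
  \<open>fix_sign\<close> repairs.\<close>

definition intertwines :: "'q::finite qop \<Rightarrow> ('q \<Rightarrow> bool) \<Rightarrow> ('q \<Rightarrow> bool) \<Rightarrow> ('q \<Rightarrow> bool) \<Rightarrow> ('q \<Rightarrow> bool) \<Rightarrow> bool" where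
  "intertwines U a b a' b' \<longleftrightarrow> (\<exists>c. c \<noteq> 0 \<and> U ** pauli a b = cscale c (pauli a' b' ** U))"

lemma intertwines_mult:
  assumes "intertwines U a b a' b'" "intertwines V a' b' a'' b''"
  shows "intertwines (V ** U) a b a'' b''"
proof -
  obtain c d where "c \<noteq> 0" "d \<noteq> 0" and c: "U ** pauli a b = cscale c (pauli a' b' ** U)"
    and d: "V ** pauli a' b' = cscale d (pauli a'' b'' ** V)"
    using assms by (auto simp: intertwines_def)
  have "V ** U ** pauli a b = V ** (U ** pauli a b)" by (simp add: matrix_mul_assoc)
  also have "\<dots> = cscale c (V ** pauli a' b' ** U)" by (simp add: c matrix_mul_assoc)
  also have "\<dots> = cscale (c * d) (pauli a'' b'' ** (V ** U))" by (simp add: d matrix_mul_assoc)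
  finally show ?thesis using \<open>c \<noteq> 0\<close> \<open>d \<noteq> 0\<close> unfolding intertwines_def by (meson mult_eq_0_iff)
qed

lemma intertwines_cscale: "intertwines U a b a' b' \<Longrightarrow> intertwines (cscale c U) a b a' b'"
  by (auto simp: intertwines_def mult.commute)

text \<open>Conjugation preserves commutation signs: moving \<open>U\<close> past a product of two
  strings in either order produces the same scalar \<open>c * d\<close>, so only the signs remain.
  The induced action on pairs of bit strings is thus symplectic.\<close>

lemma intertwines_csign:
  assumes "unit_det U" "intertwines U a b a' b'" "intertwines U x y x' y'"
  shows "csign a' b' x' y' = csign a b x y"
proof -
  obtain c d where "c \<noteq> 0" "d \<noteq> 0" and c: "U ** pauli a b = cscale c (pauli a' b' ** U)"
    and d: "U ** pauli x y = cscale d (pauli x' y' ** U)"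
    using assms by (auto simp: intertwines_def)
  have *: "U ** (pauli a b ** pauli x y) = cscale (c * d) (pauli a' b' ** pauli x' y') ** U"
  proof -
    have "U ** (pauli a b ** pauli x y) = cscale c (pauli a' b' ** (U ** pauli x y))"
      by (simp add: c matrix_mul_assoc)
    then show ?thesis by (simp add: d matrix_mul_assoc)
  qed
  have "U ** (pauli x y ** pauli a b) = cscale (c * d) (pauli x' y' ** pauli a' b') ** U"
  proof -
    have "U ** (pauli x y ** pauli a b) = cscale d (pauli x' y' ** (U ** pauli a b))"
      by (simp add: d matrix_mul_assoc)
    then show ?thesis by (simp add: c matrix_mul_assoc mult.commute)
  qed
  then have "U ** (pauli a b ** pauli x y) =
      cscale (csign a b x y * (c * d)) (pauli x' y' ** pauli a' b') ** U"
    by (simp add: pauli_commute[of a b x y])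
  with * have "cscale (c * d) (pauli a' b' ** pauli x' y')
      = cscale (csign a b x y * (c * d)) (pauli x' y' ** pauli a' b')"
    using unit_det_cancel[OF assms(1)] by metis
  then have "cscale (c * d * csign a' b' x' y') (pauli x' y' ** pauli a' b')
      = cscale (csign a b x y * (c * d)) (pauli x' y' ** pauli a' b')"
    by (simp add: pauli_commute[of a' b' x' y'])
  \<comment> \<open>Both sides are multiples of one Pauli string; \<open>chi y' a'\<close> is the
    sign from multiplying the two strings out, and it is nonzero.\<close>
  then have "c * d * csign a' b' x' y' * chi y' a' = csign a b x y * (c * d) * chi y' a'"
    unfolding pauli_mult cscale_cscale by (rule pauli_inject_scale)
  then show ?thesis using \<open>c \<noteq> 0\<close> \<open>d \<noteq> 0\<close> chi_cases[of y' a'] by auto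
qed

text \<open>All that the synthesis needs to know of a Clifford unitary. It concerns the matrix
  rather than a word in the generators, so partially reduced operators keep it.\<close>

definition normalizes :: "'q::finite qop \<Rightarrow> bool" where
  "normalizes U \<longleftrightarrow> unit_det U \<and> (\<forall>a b. \<exists>a' b'. intertwines U a b a' b')"

lemma normalizes_mult: "normalizes U \<Longrightarrow> normalizes V \<Longrightarrow> normalizes (U ** V)"
  unfolding normalizes_def by (meson intertwines_mult unit_det_mult)

lemma normalizes_cscale:
  assumes "cmod c = 1" "normalizes U"
  shows "normalizes (cscale c U)"
  unfolding normalizes_def
proof (intro conjI allI)
  show "unit_det (cscale c U)" using assms by (simp add: normalizes_def unit_det_cscale)
  fix a b
  obtain a' b' where "intertwines U a b a' b'" using assms(2) unfolding normalizes_def by meson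
  then have "intertwines (cscale c U) a b a' b'" by (rule intertwines_cscale)
  then show "\<exists>a' b'. intertwines (cscale c U) a b a' b'" by blast
qed

section \<open>Action of the Clifford generators on Pauli strings\<close>

lemma on_qubit_mult_nth:
  "(on_qubit q M ** B) $ u $ v = (\<Sum>t\<in>UNIV. M $ (u q) $ t * B $ (u(q := t)) $ v)"
proof -
  have "(on_qubit q M ** B) $ u $ v
      = (\<Sum>w\<in>UNIV. if \<forall>p. p \<noteq> q \<longrightarrow> u p = w p then M $ u q $ w q * B $ w $ v else 0)"
    by (simp add: matrix_matrix_mult_def on_qubit_def if_distrib[of "\<lambda>x. x * _"] cong: if_cong)
  \<comment> \<open>A row of \<open>on_qubit q M\<close> lives on the states that agree with
    \<open>u\<close> off \<open>q\<close>, which are the two updates of \<open>u\<close> at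
    \<open>q\<close>.\<close>
  also have "\<dots> = (\<Sum>w\<in>(\<lambda>t. u(q := t)) ` UNIV. M $ u q $ w q * B $ w $ v)"
  proof (rule sum.mono_neutral_cong_right)
    have "w = u(q := w q)" if "\<forall>p. p \<noteq> q \<longrightarrow> u p = w p" for w
      using that by (auto simp: fun_eq_iff)
    then show "\<forall>w\<in>UNIV - range (\<lambda>t. u(q := t)).
        (if \<forall>p. p \<noteq> q \<longrightarrow> u p = w p then M $ u q $ w q * B $ w $ v else 0) = 0"
      by auto
  qed auto
  also have "\<dots> = (\<Sum>t\<in>UNIV. M $ (u q) $ t * B $ (u(q := t)) $ v)"
  proof (subst sum.reindex)
    show "inj (\<lambda>t. u(q := t))" by (rule injI) (metis fun_upd_same)
  qed simp
  finally show ?thesis .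
qed

lemma on_qubit_mult: "on_qubit q M ** on_qubit q N = on_qubit q (M ** N)"
proof -
  have "(on_qubit q M ** on_qubit q N) $ u $ v = on_qubit q (M ** N) $ u $ v" for u v
  proof -
    define P where "P \<longleftrightarrow> (\<forall>p. p \<noteq> q \<longrightarrow> u p = v p)"
    have nth: "on_qubit q N $ (u(q := t)) $ v = (if P then N $ t $ v q else 0)" for t
      unfolding on_qubit_def P_def by auto
    show ?thesis
      unfolding on_qubit_mult_nth nth
      by (simp add: on_qubit_def matrix_matrix_mult_def flip: P_def)
  qed
  then show ?thesis by (simp add: vec_eq_iff)
qed

lemma on_qubit_mat_1: "on_qubit q (mat 1) = mat 1"
  by (auto simp: on_qubit_def mat_def vec_eq_iff fun_eq_iff)

lemma sqrt_2_square: "complex_of_real (sqrt 2) * complex_of_real (sqrt 2) = 2"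
  by (simp flip: of_real_mult)

lemma hadamard_square: "hadamard ** hadamard = mat 1"
proof -
  have "(hadamard ** hadamard) $ s $ t = (mat 1 :: qop1) $ s $ t" for s t
    by (cases s; cases t) (simp_all add: hadamard_def matrix_matrix_mult_def mat_def UNIV_bool sqrt_2_square)
  then show ?thesis by (simp add: vec_eq_iff)
qed

lemma phase_S_square: "phase_S ** phase_S = (\<chi> s t. if s = t then sg s else 0)"
  by (auto simp: phase_S_def matrix_matrix_mult_def vec_eq_iff UNIV_bool)

lemma phase_S_order: "(phase_S ** phase_S) ** (phase_S ** phase_S) = mat 1"
  unfolding phase_S_square
  by (auto simp: matrix_matrix_mult_def vec_eq_iff UNIV_bool mat_def)

text \<open>The factors of \<open>chi\<close> away from \<open>q\<close> are the same on both sides,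
  so only an identity between entries of the 2 by 2 matrix \<open>M\<close> has to be
  checked.\<close>

lemma intertwines_on_qubit:
  assumes "c \<noteq> 0"
    and M: "\<And>s t. M $ s $ (t \<noteq> a q) * sg (b q \<and> t) = c * sg (b' \<and> (s \<noteq> a')) * M $ (s \<noteq> a') $ t"
  shows "on_qubit q M ** pauli a b = cscale c (pauli (a(q := a')) (b(q := b')) ** on_qubit q M)"
proof -
  have "(on_qubit q M ** pauli a b) $ u $ v = cscale c (pauli (a(q := a')) (b(q := b')) ** on_qubit q M) $ u $ v"
    for u v
  proof (cases "\<forall>p. p \<noteq> q \<longrightarrow> u p = (v p \<noteq> a p)")
    case True
    then have eq: "(\<Prod>j\<in>-{q}. sg ((b(q := b')) j \<and> (u \<oplus> a(q := a')) j)) = (\<Prod>j\<in>-{q}. sg (b j \<and> v j))"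
      by (intro prod.cong) (auto simp: bxor_def)
    have "(on_qubit q M ** pauli a b) $ u $ v
        = (M $ u q $ (v q \<noteq> a q) * sg (b q \<and> v q)) * (\<Prod>j\<in>-{q}. sg (b j \<and> v j))"
      using True by (simp add: mult_pauli_nth on_qubit_def chi_split[of b v q] bxor_def)
    moreover have "cscale c (pauli (a(q := a')) (b(q := b')) ** on_qubit q M) $ u $ v =
       (c * sg (b' \<and> (u q \<noteq> a')) * M $ (u q \<noteq> a') $ v q) * (\<Prod>j\<in>-{q}. sg (b j \<and> v j))"
      using True unfolding cscale_nth pauli_mult_nth chi_split[of _ _ q] eq
      by (auto simp: on_qubit_def bxor_def)
    ultimately show ?thesis by (simp only: M)
  next
    case False
    then show ?thesis by (auto simp: mult_pauli_nth pauli_mult_nth on_qubit_def bxor_def)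
  qed
  then show ?thesis by (simp add: vec_eq_iff)
qed

text \<open>X and Z are exchanged at \<open>q\<close>; the sign appears when both are present,
  because X and Z anticommute.\<close>

lemma hadamard_pauli:
  "on_qubit q hadamard ** pauli a b
    = cscale (sg (a q \<and> b q)) (pauli (a(q := b q)) (b(q := a q)) ** on_qubit q hadamard)"
proof (rule intertwines_on_qubit)
  show "hadamard $ s $ (t \<noteq> a q) * sg (b q \<and> t)
      = sg (a q \<and> b q) * sg (a q \<and> (s \<noteq> b q)) * hadamard $ (s \<noteq> b q) $ t" for s t
    by (cases "a q"; cases "b q"; cases s; cases t) (simp_all add: hadamard_def)
qed (simp add: sg_def)

text \<open>Conjugation by the phase gate fixes Z and takes X to Y, which is \<open>\<i>\<close>
  times XZ.\<close>

lemma phase_S_pauli: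
  "on_qubit q phase_S ** pauli a b
    = cscale (if a q then \<i> else 1) (pauli a (b(q := (b q \<noteq> a q))) ** on_qubit q phase_S)"
proof -
  have "on_qubit q phase_S ** pauli a b
    = cscale (if a q then \<i> else 1) (pauli (a(q := a q)) (b(q := (b q \<noteq> a q))) ** on_qubit q phase_S)"
  proof (rule intertwines_on_qubit)
    show "phase_S $ s $ (t \<noteq> a q) * sg (b q \<and> t)
        = (if a q then \<i> else 1) * sg ((b q \<noteq> a q) \<and> (s \<noteq> a q)) * phase_S $ (s \<noteq> a q) $ t" for s t
      by (cases "a q"; cases "b q"; cases s; cases t) (simp_all add: phase_S_def)
  qed simp
  then show ?thesis by simp
qed

text \<open>X spreads from the control to the target and Z from the target to the control.\<close>

lemma cnot_pauli:
  assumes "p \<noteq> q"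
  shows "cnot p q ** pauli a b = pauli (a(q := (a q \<noteq> a p))) (b(p := (b p \<noteq> b q))) ** cnot p q"
proof -
  let ?a = "a(q := (a q \<noteq> a p))" and ?b = "b(p := (b p \<noteq> b q))"
  \<comment> \<open>The update of \<open>b\<close> is the transpose of the update of
    \<open>v\<close>: the extra term \<open>b q \<and> v p\<close> arises twice and cancels.\<close>
  have chi: "chi ?b (v(q := (v q \<noteq> v p))) = chi b v" for v
  proof -
    have split: "chi x y = sg (x p \<and> y p) * sg (x q \<and> y q) * (\<Prod>j\<in>-{p,q}. sg (x j \<and> y j))" for x y
    proof -
      have "(\<Prod>j\<in>-{p}. sg (x j \<and> y j)) = sg (x q \<and> y q) * (\<Prod>j\<in>-{p} - {q}. sg (x j \<and> y j))"
        using assms by (intro prod.remove) auto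
      moreover have "-{p} - {q} = -{p,q}" by auto
      ultimately show ?thesis by (simp add: chi_split[of x y p] mult.assoc)
    qed
    have "(\<Prod>j\<in>-{p,q}. sg (?b j \<and> (v(q := (v q \<noteq> v p))) j)) = (\<Prod>j\<in>-{p,q}. sg (b j \<and> v j))"
      by (rule prod.cong) auto
    then show ?thesis unfolding split using assms by (auto simp: sg_def)
  qed
  have "(cnot p q ** pauli a b) $ u $ v = (pauli ?a ?b ** cnot p q) $ u $ v" for u v
  proof -
    have *: "u = (v \<oplus> a)(q := ((v \<oplus> a) q \<noteq> (v \<oplus> a) p)) \<longleftrightarrow> u \<oplus> ?a = v(q := (v q \<noteq> v p))"
      using assms by (auto simp: fun_eq_iff bxor_def)
    show ?thesis
      unfolding mult_pauli_nth pauli_mult_nth cnot_def vec_lambda_beta *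
      using chi[of v] by (cases "u \<oplus> ?a = v(q := (v q \<noteq> v p))") simp_all
  qed
  then show ?thesis by (simp add: vec_eq_iff)
qed

lemma cnot_square:
  assumes "p \<noteq> q"
  shows "cnot p q ** cnot p q = mat 1"
proof -
  define f where "f u = u(q := (u q \<noteq> u p))" for u :: "'a \<Rightarrow> bool"
  have f: "f (f u) = u" for u
    unfolding f_def using assms by (intro ext) auto
  then have f_eq: "u = f v \<longleftrightarrow> v = f u" for u v
    by metis
  have "(cnot p q ** cnot p q) $ u $ v = (mat 1 :: 'a qop) $ u $ v" for u v :: "'a \<Rightarrow> bool"
  proof -
    have "(cnot p q ** cnot p q) $ u $ v = (\<Sum>w\<in>UNIV. (if w = f u then 1 else 0) * (if w = f v then 1 else 0))"
      unfolding matrix_matrix_mult_def cnot_def vec_lambda_beta f_def[symmetric] f_eq[of u] ..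
    also have "\<dots> = (\<Sum>w\<in>UNIV. if w = f u then (if w = f v then 1 else 0) else 0)"
      by (intro sum.cong refl) simp
    also have "\<dots> = (if f u = f v then 1 else 0)"
      by (subst sum.delta) simp_all
    also have "f u = f v \<longleftrightarrow> u = v"
      using f by metis
    finally show ?thesis by (simp add: mat_def)
  qed
  then show ?thesis by (simp add: vec_eq_iff)
qed

lemma normalizes_hadamard: "normalizes (on_qubit q hadamard)"
  unfolding normalizes_def
proof (intro conjI allI)
  show "unit_det (on_qubit q hadamard)"
    by (rule unit_det_of_power[where c=1]) (simp_all add: on_qubit_mult hadamard_square on_qubit_mat_1)
  fix a b
  have "sg (a q \<and> b q) \<noteq> (0::complex)" by (simp add: sg_def)
  then have "intertwines (on_qubit q hadamard) a b (a(q := b q)) (b(q := a q))"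
    unfolding intertwines_def using hadamard_pauli by blast
  then show "\<exists>a' b'. intertwines (on_qubit q hadamard) a b a' b'" by blast
qed

lemma normalizes_phase_S: "normalizes (on_qubit q phase_S)"
  unfolding normalizes_def
proof (intro conjI allI)
  show "unit_det (on_qubit q phase_S)"
    by (rule unit_det_of_power[where c=1]) (simp_all add: on_qubit_mult phase_S_order on_qubit_mat_1)
  fix a b
  have "(if a q then \<i> else 1) \<noteq> (0::complex)" by (simp add: sg_def)
  then have "intertwines (on_qubit q phase_S) a b a (b(q := (b q \<noteq> a q)))"
    unfolding intertwines_def using phase_S_pauli by blast
  then show "\<exists>a' b'. intertwines (on_qubit q phase_S) a b a' b'" by blast
qed

lemma normalizes_cnot:
  assumes "p \<noteq> q"
  shows "normalizes (cnot p q)"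
  unfolding normalizes_def
proof (intro conjI allI)
  show "unit_det (cnot p q)"
    by (rule unit_det_of_power[where c=1]) (simp_all add: cnot_square assms)
  fix a b
  have "intertwines (cnot p q) a b (a(q := (a q \<noteq> a p))) (b(p := (b p \<noteq> b q)))"
    unfolding intertwines_def cnot_pauli[OF assms] by (rule exI[of _ 1]) simp
  then show "\<exists>a' b'. intertwines (cnot p q) a b a' b'" by blast
qed

text \<open>The only use of the word in the generators that \<open>clifford\<close>
  provides.\<close>

lemma normalizes_clifford:
  assumes "clifford U"
  shows "normalizes U"
proof -
  obtain gs c where gs: "set gs \<subseteq> clifford_gates" and c: "cmod c = 1" and U: "U = cscale c (cmat_prod gs)"
    using assms by (auto simp: clifford_def eq_up_to_phase_def)
  have "normalizes (cmat_prod gs)"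
    using gs
  proof (induction gs)
    case Nil
    have "intertwines (mat 1) a b a b" for a b :: "'a \<Rightarrow> bool"
      unfolding intertwines_def by (rule exI[of _ 1]) simp
    then have "normalizes (mat 1 :: 'a qop)"
      unfolding normalizes_def using unit_det_mat_1 by blast
    then show ?case by (simp add: cmat_prod_def)
  next
    case (Cons g gs)
    then have "normalizes g"
      by (auto simp: clifford_gates_def normalizes_hadamard normalizes_phase_S normalizes_cnot)
    then show ?case using Cons normalizes_mult[of g "cmat_prod gs"] by (simp add: cmat_prod_def)
  qed
  then show ?thesis
    unfolding U by (rule normalizes_cscale[OF c])
qed

section \<open>Circuits and Pauli rotations\<close>

lemma cmat_prod_append: "cmat_prod (xs @ ys) = cmat_prod xs ** cmat_prod ys"
  by (induction xs) (simp_all add: cmat_prod_def matrix_mul_assoc)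

definition realizable :: "nat \<Rightarrow> 'q::finite qop \<Rightarrow> bool" where
  "realizable k U \<longleftrightarrow> (\<exists>C. (\<forall>g \<in> set C. admissible_gate g) \<and>
     eq_up_to_phase U (circuit_op C) \<and> gms_count C \<le> k)"

lemma realizable_mult:
  assumes "realizable j U" "realizable k V"
  shows "realizable (j + k) (U ** V)"
proof -
  obtain C c where C: "\<forall>g \<in> set C. admissible_gate g" "gms_count C \<le> j"
    and c: "cmod c = 1" "U = cscale c (circuit_op C)"
    using assms(1) by (auto simp: realizable_def eq_up_to_phase_def)
  obtain D d where D: "\<forall>g \<in> set D. admissible_gate g" "gms_count D \<le> k"
    and d: "cmod d = 1" "V = cscale d (circuit_op D)"
    using assms(2) by (auto simp: realizable_def eq_up_to_phase_def)
  \<comment> \<open>The right factor acts first, so its circuit is the front part of the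
    list.\<close>
  have "U ** V = cscale (d * c) (circuit_op (D @ C))"
    by (simp add: c d circuit_op_def cmat_prod_append)
  moreover have "cmod (d * c) = 1"
    using c d by (simp add: norm_mult)
  ultimately show ?thesis
    unfolding realizable_def eq_up_to_phase_def using C D
    by (intro exI[of _ "D @ C"]) (auto simp: gms_count_def)
qed

lemma realizable_mult_local: "realizable 0 U \<Longrightarrow> realizable k V \<Longrightarrow> realizable k (U ** V)"
  "realizable k U \<Longrightarrow> realizable 0 V \<Longrightarrow> realizable k (U ** V)"
  using realizable_mult[of 0 U k V] realizable_mult[of k U 0 V] by simp_all

lemma realizable_mono: "realizable j U \<Longrightarrow> j \<le> k \<Longrightarrow> realizable k U"
  unfolding realizable_def by (meson le_trans)

lemma realizable_cscale:
  assumes "cmod c = 1" "realizable k U"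
  shows "realizable k (cscale c U)"
proof -
  obtain C d where C: "\<forall>g \<in> set C. admissible_gate g" "gms_count C \<le> k"
    and d: "cmod d = 1" "U = cscale d (circuit_op C)"
    using assms(2) by (auto simp: realizable_def eq_up_to_phase_def)
  have "cscale c U = cscale (c * d) (circuit_op C)" "cmod (c * d) = 1"
    using assms(1) d by (simp_all add: norm_mult)
  then show ?thesis
    unfolding realizable_def eq_up_to_phase_def using C by blast
qed

lemma eq_up_to_phase_refl: "eq_up_to_phase U U"
  unfolding eq_up_to_phase_def by (rule exI[of _ 1]) simp

lemma realizable_mat_1: "realizable k (mat 1)"
  unfolding realizable_def
  by (rule exI[of _ "[]"]) (simp add: circuit_op_def cmat_prod_def gms_count_def eq_up_to_phase_refl)

lemma realizable_gms: "realizable 1 (gms S \<alpha>)"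
  unfolding realizable_def
  by (rule exI[of _ "[GMS S \<alpha>]"]) (simp add: circuit_op_def cmat_prod_def gms_count_def eq_up_to_phase_refl)

lemma realizable_on_qubit:
  assumes "M \<in> {hadamard, phase_S}"
  shows "realizable 0 (on_qubit q M)"
proof -
  have "clifford1 M"
    unfolding clifford1_def using assms
    by (intro exI[of _ "[M]"]) (simp add: cmat_prod_def eq_up_to_phase_refl)
  then show ?thesis
    unfolding realizable_def
    by (intro exI[of _ "[Local q M]"]) (simp add: circuit_op_def cmat_prod_def gms_count_def eq_up_to_phase_refl)
qed

lemma realizable_hadamard: "realizable 0 (on_qubit q hadamard)"
  and realizable_phase_S: "realizable 0 (on_qubit q phase_S)"
  by (simp_all add: realizable_on_qubit)

lemma hadamard_inverse: "on_qubit q hadamard ** on_qubit q hadamard = mat 1"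
  by (simp add: on_qubit_mult hadamard_square on_qubit_mat_1)

lemma phase_S_inverse:
  "(on_qubit q phase_S ** on_qubit q phase_S ** on_qubit q phase_S) ** on_qubit q phase_S = mat 1"
  using phase_S_order by (simp add: on_qubit_mult on_qubit_mat_1 matrix_mul_assoc)

section \<open>Diagonal operators and local Pauli gates\<close>

definition diagm :: "('b::finite \<Rightarrow> complex) \<Rightarrow> 'b cmat" where
  "diagm d = (\<chi> u v. if u = v then d u else 0)"

lemma diagm_nth: "diagm d $ u $ v = (if u = v then d u else 0)"
  by (simp add: diagm_def)

lemma diagm_mult: "diagm d ** diagm d' = diagm (\<lambda>u. d u * d' u)"
proof -
  have "(diagm d ** diagm d') $ u $ v = diagm (\<lambda>u. d u * d' u) $ u $ v" for u v
  proof -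
    have "(diagm d ** diagm d') $ u $ v = (\<Sum>w\<in>UNIV. if w = u then (if u = v then d u * d' u else 0) else 0)"
      unfolding matrix_matrix_mult_def vec_lambda_beta diagm_nth by (rule sum.cong) auto
    then show ?thesis by (simp add: diagm_nth)
  qed
  then show ?thesis by (simp add: vec_eq_iff)
qed

lemma diagm_one: "diagm (\<lambda>_. 1) = mat 1"
  by (simp add: diagm_def mat_def)

lemma cscale_diagm: "cscale c (diagm d) = diagm (\<lambda>u. c * d u)"
  by (simp add: vec_eq_iff diagm_nth)

lemma on_qubit_phase_S: "on_qubit q phase_S = diagm (\<lambda>u. if u q then \<i> else 1)"
proof -
  have "on_qubit q phase_S $ u $ v = diagm (\<lambda>u. if u q then \<i> else 1) $ u $ v" for u v
  proof (cases "u = v")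
    case True
    then show ?thesis by (simp add: on_qubit_def phase_S_def diagm_nth)
  next
    case False
    then obtain p where "u p \<noteq> v p" by auto
    with False show ?thesis
      by (cases "p = q") (auto simp: on_qubit_def phase_S_def diagm_nth)
  qed
  then show ?thesis by (simp add: vec_eq_iff)
qed

text \<open>Exponent 2 gives Pauli Z; the odd exponents give the diagonal rotations about Z on one
  qubit, up to phase.\<close>

lemma realizable_phase_power: "realizable 0 (diagm (\<lambda>u. if u q then \<i> ^ k else 1))"
proof (induction k)
  case 0
  then show ?case by (simp add: diagm_one realizable_mat_1 cong: if_cong)
next
  case (Suc k)
  have "diagm (\<lambda>u. if u q then \<i> ^ Suc k else 1)
      = on_qubit q phase_S ** diagm (\<lambda>u. if u q then \<i> ^ k else 1)"
    unfolding on_qubit_phase_S diagm_mult by (rule arg_cong[of _ _ diagm]) auto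
  then show ?case using Suc realizable_mult_local realizable_phase_S by metis
qed

lemma pauli_Z_diagm: "pauli none b = diagm (chi b)"
  by (simp add: vec_eq_iff pauli_def diagm_nth)

lemma realizable_pauli_Z: "realizable 0 (pauli none (single q))"
proof -
  have "pauli none (single q) = diagm (\<lambda>u. if u q then \<i> ^ 2 else 1)"
    unfolding pauli_Z_diagm by (rule arg_cong[of _ _ diagm]) (auto simp: sg_def)
  then show ?thesis by (simp only: realizable_phase_power)
qed

lemma hadamard_pauli_Z: "on_qubit q hadamard ** pauli none (single q) = pauli (single q) none ** on_qubit q hadamard"
proof -
  have "none(q := single q q) = single q" "(single q)(q := none q) = none"
    by (auto simp: single_def fun_eq_iff)
  then show ?thesis using hadamard_pauli[of q none "single q"] by simp
qed

lemma realizable_pauli_X: "realizable 0 (pauli (single q) none)"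
proof -
  have "pauli (single q) none = on_qubit q hadamard ** pauli none (single q) ** on_qubit q hadamard"
    unfolding hadamard_pauli_Z matrix_mul_assoc[symmetric] hadamard_inverse by simp
  then show ?thesis
    by (simp only: realizable_mult_local realizable_hadamard realizable_pauli_Z)
qed

section \<open>Rotations about Pauli strings\<close>

definition rot :: "complex \<Rightarrow> ('q::finite \<Rightarrow> bool) \<Rightarrow> ('q \<Rightarrow> bool) \<Rightarrow> 'q qop" where
  "rot e a b = cscale (1 / complex_of_real (sqrt 2)) (mat 1 + cscale e (pauli a b))"

lemma rot_mult:
  "rot e a b ** rot f a b = cscale (1 / 2) (cscale (1 + e * f * chi b a) (mat 1) + cscale (e + f) (pauli a b))"
  by (simp add: rot_def matrix_add_ldistrib matrix_add_rdistrib pauli_square cscale_add sqrt_2_square)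
    (simp add: vec_eq_iff algebra_simps add_divide_distrib)

text \<open>
  A rotation \<open>rot e a b\<close> is unitary when \<open>e\<^sup>2 chi b a = - 1\<close>, that is, when
  \<open>e\<close> times the Pauli string squares to \<open>- 1\<close>.
\<close>

lemma rot_inverse:
  assumes "e * e * chi b a = - 1"
  shows "rot (- e) a b ** rot e a b = mat 1"
  using assms by (simp add: rot_mult vec_eq_iff)

text \<open>The rotation is a square root of \<open>e\<close> times the string, whose square is
  \<open>- 1\<close>.\<close>

lemma unit_det_rot:
  assumes "e * e * chi b a = - 1"
  shows "unit_det (rot e a b)"
proof (rule unit_det_of_power)
  have "rot e a b ** rot e a b = cscale e (pauli a b)"
    using assms by (simp add: rot_mult vec_eq_iff)
  then show "(rot e a b ** rot e a b) ** (rot e a b ** rot e a b) = cscale (- 1) (mat 1)"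
    using assms by (simp add: pauli_square mult.assoc)
qed simp

lemma ex_rot_coeff: "\<exists>e. e * e * chi b a = - 1"
  using chi_cases[of b a] by (auto intro: exI[of _ "\<i>"] exI[of _ 1])

lemma rot_commute:
  assumes "csign a b x y = 1"
  shows "rot e a b ** pauli x y = pauli x y ** rot e a b"
  using pauli_commute[of a b x y] assms
  by (simp add: rot_def matrix_add_ldistrib matrix_add_rdistrib)

text \<open>The transvection law. For anticommuting P and Q one has PQP = - P^2 Q, hence
  \<open>e * e\<close> times PQP is Q; therefore \<open>e\<close> PQ (1 + \<open>e\<close> P) = (1 +
  \<open>e\<close> P) Q.\<close>

lemma intertwines_rot:
  assumes "e * e * chi b a = - 1" "csign a b x y = - 1"
  shows "intertwines (rot e a b) x y (a \<oplus> x) (b \<oplus> y)"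
proof -
  let ?P = "pauli a b" and ?Q = "pauli x y"
  have PQ: "?P ** ?Q = cscale (- 1) (?Q ** ?P)"
    using pauli_commute[of a b x y] assms(2) by simp
  have PQP: "?P ** ?Q ** ?P = cscale (- chi b a) ?Q"
    unfolding PQ by (simp add: pauli_square flip: matrix_mul_assoc)
  have c: "e * chi b x \<noteq> 0"
    using assms(1) chi_cases[of b x] by auto
  have "cscale (e * chi b x) (pauli (a \<oplus> x) (b \<oplus> y)) = cscale e (?P ** ?Q)"
    by (simp add: pauli_mult)
  then have "cscale (e * chi b x) (pauli (a \<oplus> x) (b \<oplus> y) ** rot e a b) = cscale e (?P ** ?Q) ** rot e a b"
    by (metis cscale_mult_left)
  also have "\<dots> = cscale (1 / complex_of_real (sqrt 2)) (cscale e (?P ** ?Q) + cscale (e * e) (?P ** ?Q ** ?P))"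
    by (simp add: rot_def matrix_add_ldistrib cscale_add mult_ac)
  also have "cscale (e * e) (?P ** ?Q ** ?P) = ?Q"
    unfolding PQP using assms(1) by simp
  also have "cscale (1 / complex_of_real (sqrt 2)) (cscale e (?P ** ?Q) + ?Q) = rot e a b ** ?Q"
    by (simp add: rot_def matrix_add_rdistrib add.commute)
  finally show ?thesis
    unfolding intertwines_def using c by metis
qed

lemma intertwines_of_commute:
  assumes "U ** pauli a b = pauli a b ** U"
  shows "intertwines U a b a b"
  unfolding intertwines_def by (rule exI[of _ 1]) (simp add: assms)

lemma normalizes_rot:
  assumes "e * e * chi b a = - 1"
  shows "normalizes (rot e a b)"
  unfolding normalizes_def
proof (intro conjI allI)
  show "unit_det (rot e a b)" by (rule unit_det_rot[OF assms])
  fix x y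
  show "\<exists>x' y'. intertwines (rot e a b) x y x' y'"
    using csign_cases[of a b x y] intertwines_rot[OF assms] intertwines_of_commute[OF rot_commute] by meson
qed

text \<open>If \<open>G\<close> takes the string to \<open>c\<close> times the new one, the new
  coefficient is \<open>e * c\<close>. It is again admissible because conjugation does not change
  the scalar to which the string squares.\<close>

lemma rot_conj:
  assumes "unit_det G" "intertwines G a b a' b'" "e * e * chi b a = - 1"
  obtains e' where "e' * e' * chi b' a' = - 1" "G ** rot e a b = rot e' a' b' ** G"
proof -
  obtain c where c: "G ** pauli a b = cscale c (pauli a' b' ** G)"
    using assms(2) by (auto simp: intertwines_def)
  have "cscale (chi b a) (mat 1) ** G = (G ** pauli a b) ** pauli a b"
    by (simp add: pauli_square flip: matrix_mul_assoc)
  also have "\<dots> = cscale (c * c) (pauli a' b' ** pauli a' b') ** G"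
    by (simp add: c flip: matrix_mul_assoc)
  also have "\<dots> = cscale (c * c * chi b' a') (mat 1) ** G"
    by (simp add: pauli_square)
  finally have "cscale (chi b a) (mat 1 :: 'a qop) = cscale (c * c * chi b' a') (mat 1)"
    using unit_det_cancel[OF assms(1)] by blast
  then have chi: "chi b a = c * c * chi b' a'"
    unfolding pauli_none[symmetric] by (rule pauli_inject_scale)
  show thesis
  proof
    show "(e * c) * (e * c) * chi b' a' = - 1"
      using assms(3) chi by (simp add: mult_ac)
    show "G ** rot e a b = rot (e * c) a' b' ** G"
      by (simp add: rot_def matrix_add_ldistrib matrix_add_rdistrib c)
  qed
qed

text \<open>Local gates turn every X or Y factor into Z, one qubit of \<open>a\<close> at a time,
  without leaving \<open>A\<close>. Keeping \<open>A\<close> and \<open>k\<close> general serves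
  both the free single-qubit case and the case of one gate.\<close>

lemma realizable_rot_of_Z:
  assumes base: "\<And>b e. (\<And>j. b j \<Longrightarrow> j \<in> A) \<Longrightarrow> e * e = - 1 \<Longrightarrow> realizable k (rot e none b)"
  shows "(\<And>j. a j \<Longrightarrow> j \<in> A) \<Longrightarrow> (\<And>j. b j \<Longrightarrow> j \<in> A) \<Longrightarrow> e * e * chi b a = - 1 \<Longrightarrow>
    realizable k (rot e a b)"
proof (induction "card {j. a j}" arbitrary: a b e)
  case 0
  then have "a = none" by (auto simp: fun_eq_iff)
  then show ?case using 0 base by simp
next
  case (Suc n)
  then have "{j. a j} \<noteq> {}" by (metis card.empty nat.distinct(1))
  then obtain q where q: "a q" by blast
  let ?H = "on_qubit q hadamard" and ?S = "on_qubit q phase_S"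
  \<comment> \<open>The rotation is \<open>G'\<close> times the simpler rotation times
    \<open>G\<close>, and both outer factors are local.\<close>
  have reduce: "realizable k (rot e a b)"
    if G: "normalizes G" "intertwines G a b (a(q := False)) (b(q := True))" "G' ** G = mat 1" "realizable 0 G'" "realizable 0 G"
    for G G'
  proof -
    obtain e' where e': "e' * e' * chi (b(q := True)) (a(q := False)) = - 1"
      and conj: "G ** rot e a b = rot e' (a(q := False)) (b(q := True)) ** G"
      using rot_conj[OF _ G(2) Suc.prems(3)] G(1) unfolding normalizes_def by blast
    have "{j. a j} = insert q {j. (a(q := False)) j}" using q by auto
    then have "n = card {j. (a(q := False)) j}" using Suc.hyps(2) by simp
    then have "realizable k (rot e' (a(q := False)) (b(q := True)))"
    proof (rule Suc.hyps(1))
      show "j \<in> A" if "(a(q := False)) j" for j using that Suc.prems(1) by (auto split: if_splits)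
      show "j \<in> A" if "(b(q := True)) j" for j using that Suc.prems(1,2) q by (auto split: if_splits)
    qed (rule e')
    then have "realizable k (G' ** (rot e' (a(q := False)) (b(q := True)) ** G))"
      by (intro realizable_mult_local G)
    then show ?thesis
      using G(3) by (simp add: matrix_mul_assoc flip: conj)
  qed
  show ?case
  proof (cases "b q")
    case False
    show ?thesis
    proof (rule reduce)
      show "intertwines ?H a b (a(q := False)) (b(q := True))"
        using hadamard_pauli[of q a b] False q by (auto simp: intertwines_def intro: exI[of _ 1])
    qed (rule normalizes_hadamard hadamard_inverse realizable_hadamard)+
  next
    case True
    \<comment> \<open>At a Y factor the phase gate first removes the Z part; the Hadamard gate then
      turns the remaining X into Z.\<close>
    have "?S ** pauli a b = cscale \<i> (pauli a (b(q := False)) ** ?S)"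
      using phase_S_pauli[of q a b] True q by simp
    then have S: "intertwines ?S a b a (b(q := False))"
      unfolding intertwines_def using complex_i_not_zero by blast
    have "?H ** pauli a (b(q := False)) = cscale 1 (pauli (a(q := False)) (b(q := True)) ** ?H)"
      using hadamard_pauli[of q a "b(q := False)"] q by simp
    then have H: "intertwines ?H a (b(q := False)) (a(q := False)) (b(q := True))"
      unfolding intertwines_def using one_neq_zero by blast
    show ?thesis
    proof (rule reduce)
      show "intertwines (?H ** ?S) a b (a(q := False)) (b(q := True))"
        by (rule intertwines_mult[OF S H])
      have "(?S ** ?S ** ?S ** ?H) ** (?H ** ?S) = ?S ** ?S ** ?S ** (?H ** ?H) ** ?S"
        by (simp only: matrix_mul_assoc)
      then show "(?S ** ?S ** ?S ** ?H) ** (?H ** ?S) = mat 1"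
        by (simp add: hadamard_inverse phase_S_inverse)
    qed (intro normalizes_mult normalizes_hadamard normalizes_phase_S realizable_mult_local
        realizable_hadamard realizable_phase_S)+
  qed
qed

lemma imaginary_unit_cases: "e * e = - 1 \<Longrightarrow> e = \<i> \<or> e = - \<i>"
  using square_eq_iff[of e "\<i>"] by simp

lemma cmod_phase: "e * e = - 1 \<Longrightarrow> cmod ((1 + e) / complex_of_real (sqrt 2)) = 1"
  by (auto dest!: imaginary_unit_cases simp: cmod_def norm_divide power_divide)

text \<open>Since \<open>e * e = - 1\<close>, the two eigenvalues satisfy 1 - \<open>e\<close> = (1
  + \<open>e\<close>) (- \<open>e\<close>). The conjugated \<open>GMS\<close> gate is brought to
  this same normal form.\<close>

lemma rot_Z_diagm:
  assumes "e * e = - 1"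
  shows "rot e none b = cscale ((1 + e) / complex_of_real (sqrt 2)) (diagm (\<lambda>u. if chi b u = 1 then 1 else - e))"
proof -
  have "(1 + e * chi b u) = (1 + e) * (if chi b u = 1 then 1 else - e)" for u
    using chi_cases[of b u] assms by (auto simp: algebra_simps)
  then have "(1 + e * chi b u) / complex_of_real (sqrt 2) =
     (1 + e) / complex_of_real (sqrt 2) * (if chi b u = 1 then 1 else - e)" for u
    by simp
  moreover have "rot e none b = diagm (\<lambda>u. (1 + e * chi b u) / complex_of_real (sqrt 2))"
    by (simp add: rot_def pauli_Z_diagm vec_eq_iff diagm_nth mat_def)
  ultimately show ?thesis by (simp add: cscale_diagm)
qed

lemma realizable_rot_single:
  assumes "\<And>j. b j \<Longrightarrow> j = q" "e * e = - 1"
  shows "realizable 0 (rot e none b)"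
proof -
  define d where "d = (\<lambda>u. if chi b u = 1 then 1 else - e)"
  have "b = none \<or> b = single q"
    using assms(1) by (auto simp: single_def fun_eq_iff)
  then have "realizable 0 (diagm d)"
  proof
    assume "b = none"
    then show ?thesis by (simp add: d_def diagm_one realizable_mat_1)
  next
    assume b: "b = single q"
    \<comment> \<open>The exponent is 3 for \<open>e = \<i>\<close> and 1 for
      \<open>e = - \<i>\<close>.\<close>
    obtain k where "\<i> ^ k = - e"
    proof -
      have "\<i> ^ 3 = - \<i>" by (simp add: eval_nat_numeral)
      then show ?thesis using that[of 3] that[of 1] imaginary_unit_cases[OF assms(2)] by auto
    qed
    then have "d = (\<lambda>u. if u q then \<i> ^ k else 1)"
      by (auto simp: d_def b sg_def)
    then show ?thesis by (simp only: realizable_phase_power)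
  qed
  then show ?thesis
    unfolding rot_Z_diagm[OF assms(2)] d_def by (rule realizable_cscale[OF cmod_phase[OF assms(2)]])
qed

lemma csign_comm: "csign a b x y = csign x y a b"
  by (simp add: csign_def mult.commute)

lemma csign_self: "csign a b a b = 1"
  by (simp add: csign_def)

lemma csign_bxor_left: "csign (a \<oplus> x) (b \<oplus> y) u w = csign a b u w * csign x y u w"
  by (simp add: csign_def chi_bxor_left chi_bxor_right mult_ac)

section \<open>Splitting off a qubit\<close>

definition supp :: "'q set \<Rightarrow> ('q \<Rightarrow> bool) \<Rightarrow> ('q \<Rightarrow> bool) \<Rightarrow> bool" where
  "supp A a b \<longleftrightarrow> (\<forall>j. j \<notin> A \<longrightarrow> \<not> a j \<and> \<not> b j)"

lemma csign_disjoint: "supp A a b \<Longrightarrow> supp (- A) x y \<Longrightarrow> csign a b x y = 1"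
proof -
  assume *: "supp A a b" "supp (- A) x y"
  then have "(b j \<and> x j) = False" "(y j \<and> a j) = False" for j by (auto simp: supp_def)
  then have "chi b x = 1" "chi y a = 1" by (simp_all only: chi_def sg_simps prod.neutral_const)
  then show "csign a b x y = 1" by (simp add: csign_def)
qed

lemma supp_bxor: "supp A a b \<Longrightarrow> supp A x y \<Longrightarrow> supp A (a \<oplus> x) (b \<oplus> y)"
  by (auto simp: supp_def bxor_def)

definition commutes :: "'q::finite qop \<Rightarrow> ('q \<Rightarrow> bool) \<Rightarrow> ('q \<Rightarrow> bool) \<Rightarrow> bool" where
  "commutes U a b \<longleftrightarrow> U ** pauli a b = pauli a b ** U"

lemma commutes_intertwines: "commutes U a b \<Longrightarrow> intertwines U a b a b"
  by (simp add: commutes_def intertwines_of_commute)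

lemma commutes_mult: "commutes U a b \<Longrightarrow> commutes V a b \<Longrightarrow> commutes (U ** V) a b"
  unfolding commutes_def by (metis matrix_mul_assoc)

lemma commutes_none: "commutes U none none"
  by (simp add: commutes_def)

lemma commutes_bxor:
  assumes "commutes U a b" "commutes U x y"
  shows "commutes U (a \<oplus> x) (b \<oplus> y)"
proof -
  have "pauli (a \<oplus> x) (b \<oplus> y) = cscale (chi b x) (pauli a b ** pauli x y)"
    by (simp add: pauli_mult)
  moreover have "U ** (pauli a b ** pauli x y) = (pauli a b ** pauli x y) ** U"
    using assms unfolding commutes_def by (metis matrix_mul_assoc)
  ultimately show ?thesis unfolding commutes_def by simp
qed

text \<open>Says that \<open>U\<close> acts only on the qubits in \<open>A\<close>, without a tensor
  factorisation. Commutation here is exact, so signs are already right outside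
  \<open>A\<close>.\<close>

definition fixes_outside :: "'q::finite set \<Rightarrow> 'q qop \<Rightarrow> bool" where
  "fixes_outside A U \<longleftrightarrow> normalizes U \<and> (\<forall>x y. supp (- A) x y \<longrightarrow> commutes U x y)"

lemma fixes_outside_mult: "fixes_outside A U \<Longrightarrow> fixes_outside A V \<Longrightarrow> fixes_outside A (U ** V)"
  unfolding fixes_outside_def using normalizes_mult commutes_mult by blast

text \<open>The image keeps commuting with all strings outside \<open>A\<close>; testing it against
  X and Z on a qubit \<open>j\<close> outside \<open>A\<close> shows that it is trivial at
  \<open>j\<close>.\<close>

lemma supp_image:
  assumes "fixes_outside A U" "intertwines U a b a' b'" "supp A a b"
  shows "supp A a' b'"
  unfolding supp_def
proof (intro allI impI)
  fix j assume j: "j \<notin> A"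
  have *: "csign a' b' x y = 1" if "supp (- A) x y" for x y
  proof -
    have "intertwines U x y x y"
      using that assms(1) by (simp add: fixes_outside_def commutes_intertwines)
    then have "csign a' b' x y = csign a b x y"
      using intertwines_csign assms(1,2) unfolding fixes_outside_def normalizes_def by blast
    then show ?thesis using csign_disjoint assms(3) that by metis
  qed
  have "supp (- A) (single j) none" "supp (- A) none (single j)"
    using j by (auto simp: supp_def single_def)
  then have "sg (b' j) = 1" "sg (a' j) = 1"
    using *[of "single j" none] *[of none "single j"] by (simp_all add: csign_def)
  then show "\<not> a' j \<and> \<not> b' j" by (auto simp: sg_def split: if_splits)
qed

text \<open>
  Rotations supported on a single qubit are local, hence the cost \<open>0\<close> when \<open>card A \<le> 1\<close>.
\<close>

definition undoable :: "'q::finite set \<Rightarrow> nat \<Rightarrow> 'q qop \<Rightarrow> bool" where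
  "undoable A k T \<longleftrightarrow> fixes_outside A T \<and>
    (\<exists>T'. T' ** T = mat 1 \<and> realizable (if card A \<le> 1 then 0 else k) T')"

lemma undoableI:
  assumes "fixes_outside A T" "T' ** T = mat 1" "realizable (if card A \<le> 1 then 0 else k) T'"
  shows "undoable A k T"
  unfolding undoable_def using assms by blast

lemma undoable_mult:
  assumes "undoable A j S" "undoable A k T"
  shows "undoable A (j + k) (S ** T)"
proof -
  let ?c = "\<lambda>k. if card A \<le> 1 then 0 else k"
  obtain S' T' where S': "S' ** S = mat 1" "realizable (?c j) S'" and T': "T' ** T = mat 1" "realizable (?c k) T'"
    using assms by (auto simp only: undoable_def)
  show ?thesis
  proof (rule undoableI)
    show "fixes_outside A (S ** T)"
      using assms by (simp add: undoable_def fixes_outside_mult)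
    have "(T' ** S') ** (S ** T) = T' ** (S' ** S) ** T" by (simp only: matrix_mul_assoc)
    then show "(T' ** S') ** (S ** T) = mat 1" by (simp add: S' T')
    have "realizable (?c k + ?c j) (T' ** S')" by (rule realizable_mult[OF T'(2) S'(2)])
    then show "realizable (?c (j + k)) (T' ** S')" by (simp add: add.commute split: if_splits)
  qed
qed

lemma undoable_mono: "undoable A j T \<Longrightarrow> j \<le> k \<Longrightarrow> undoable A k T"
  unfolding undoable_def by (auto intro: realizable_mono split: if_splits)

lemma intertwines_pauli: "intertwines (pauli a b) x y x y"
proof -
  have "csign a b x y \<noteq> 0" using csign_cases[of a b x y] by auto
  then show ?thesis unfolding intertwines_def using pauli_commute by blast
qed

lemma undoable_pauli:
  assumes "supp A a b" "realizable 0 (pauli a b)"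
  shows "undoable A 0 (pauli a b)"
proof -
  have "commutes (pauli a b) x y" if "supp (- A) x y" for x y
    using pauli_commute[of a b x y] csign_disjoint[OF assms(1) that] by (simp add: commutes_def)
  moreover have "normalizes (pauli a b)"
    unfolding normalizes_def using unit_det_pauli intertwines_pauli by blast
  ultimately have fixed: "fixes_outside A (pauli a b)" unfolding fixes_outside_def by blast
  have "cmod (chi b a) = 1" using chi_cases[of b a] by auto
  then have "realizable 0 (cscale (chi b a) (pauli a b))" using assms(2) by (rule realizable_cscale)
  moreover have "cscale (chi b a) (pauli a b) ** pauli a b = mat 1" by (simp add: pauli_square)
  ultimately show ?thesis by (intro undoableI[OF fixed, of "cscale (chi b a) (pauli a b)"]) (simp_all only: if_cancel)
qed

text \<open>An operator commuting with all Pauli strings is scalar: Z strings kill the off-diagonal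
  entries and X strings make the diagonal constant. The determinant then forces modulus one.\<close>

lemma realizable_scalar:
  fixes U :: "'q::finite qop"
  assumes "fixes_outside {} U"
  shows "realizable 0 U"
proof -
  have comm: "U ** pauli a b = pauli a b ** U" for a b
    using assms by (simp add: fixes_outside_def supp_def commutes_def)
  have entry: "U $ u $ (v \<oplus> a) * chi b v = chi b (u \<oplus> a) * U $ (u \<oplus> a) $ v" for a b u v
    using comm[of a b] by (metis mult_pauli_nth pauli_mult_nth)
  have off: "U $ u $ v = 0" if "u \<noteq> v" for u v
  proof -
    obtain j where "u j \<noteq> v j" using \<open>u \<noteq> v\<close> by blast
    then show ?thesis using entry[of u v none "single j"] by (auto simp: sg_def split: if_splits)
  qed
  have diag: "U $ u $ u = U $ none $ none" for u
    using entry[of u none u none] by simp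
  define c where "c = U $ none $ none"
  have U: "U = cscale c (mat 1)"
    using off diag by (auto simp: vec_eq_iff mat_def c_def)
  have "cmod c ^ CARD('q \<Rightarrow> bool) = 1"
    using assms U by (simp add: fixes_outside_def normalizes_def unit_det_def det_cscale norm_power)
  then have "cmod c = 1"
    using power_eq_imp_eq_base[of "cmod c" "CARD('q \<Rightarrow> bool)" 1] by simp
  then show ?thesis unfolding U using realizable_cscale realizable_mat_1 by blast
qed

section \<open>Removing one qubit from the set on which an operator acts\<close>

context
  fixes A :: "'q::finite set" and q :: 'q
  assumes q: "q \<in> A"
    and rot_cost: "\<And>e a b. supp A a b \<Longrightarrow> e * e * chi b a = - 1 \<Longrightarrow>
      realizable (if card A \<le> 1 then 0 else 1) (rot e a b)"
begin

lemma supp_q: "supp A (single q) none" "supp A none (single q)" "supp A (single q) (single q)"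
  using q by (auto simp: supp_def single_def)

text \<open>The rotation about the product of two anticommuting strings exchanges them up to phase.
  It commutes with every string that has the same sign against both, which later protects X on
  \<open>q\<close>.\<close>

lemma undoable_transport:
  assumes "supp A a b" "supp A x y" "csign a b x y = - 1"
  obtains T where "undoable A 1 T" "intertwines T a b x y"
    "\<And>u w. csign a b u w = csign x y u w \<Longrightarrow> commutes T u w"
proof -
  obtain e where e: "e * e * chi (b \<oplus> y) (a \<oplus> x) = - 1"
    using ex_rot_coeff by blast
  let ?T = "rot e (a \<oplus> x) (b \<oplus> y)"
  have s: "supp A (a \<oplus> x) (b \<oplus> y)" using assms supp_bxor by blast
  have comm: "commutes ?T u w" if "csign (a \<oplus> x) (b \<oplus> y) u w = 1" for u w
    unfolding commutes_def using that by (rule rot_commute)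
  have "undoable A 1 ?T"
  proof (rule undoableI)
    show "fixes_outside A ?T"
      unfolding fixes_outside_def using normalizes_rot[OF e] comm csign_disjoint[OF s] by blast
    show "rot (- e) (a \<oplus> x) (b \<oplus> y) ** ?T = mat 1" by (rule rot_inverse[OF e])
    show "realizable (if card A \<le> 1 then 0 else 1) (rot (- e) (a \<oplus> x) (b \<oplus> y))"
      by (rule rot_cost[OF s]) (simp add: e)
  qed
  moreover have "intertwines ?T a b x y"
  proof -
    have "csign (a \<oplus> x) (b \<oplus> y) a b = - 1"
      using assms(3) by (simp add: csign_bxor_left csign_self csign_comm[of x y])
    from intertwines_rot[OF e this] show ?thesis
      by (simp add: bxor_comm[of a x] bxor_comm[of b y])
  qed
  moreover have "commutes ?T u w" if "csign a b u w = csign x y u w" for u w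
    using comm that csign_cases[of x y u w] by (auto simp: csign_bxor_left)
  ultimately show thesis by (rule that)
qed

text \<open>Commuting strings are joined through an intermediate string that anticommutes with
  both.\<close>

lemma undoable_transport2:
  assumes "supp A a b" "supp A r s" "supp A x y" "csign a b r s = - 1" "csign r s x y = - 1"
  obtains T where "undoable A 2 T" "intertwines T a b x y"
    "\<And>u w. csign a b u w = csign r s u w \<Longrightarrow> csign r s u w = csign x y u w \<Longrightarrow> commutes T u w"
proof -
  obtain T where T: "undoable A 1 T" "intertwines T a b r s"
    "\<And>u w. csign a b u w = csign r s u w \<Longrightarrow> commutes T u w"
    using undoable_transport[OF assms(1,2,4)] by blast
  obtain T' where T': "undoable A 1 T'" "intertwines T' r s x y"
    "\<And>u w. csign r s u w = csign x y u w \<Longrightarrow> commutes T' u w"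
    using undoable_transport[OF assms(2,3,5)] by blast
  have "undoable A 2 (T' ** T)" using undoable_mult[OF T'(1) T(1)] by (simp add: numeral_2_eq_2)
  then show thesis using that[of "T' ** T"] intertwines_mult[OF T(2) T'(2)] commutes_mult T(3) T'(3) by blast
qed

text \<open>One rotation suffices if the string anticommutes with X on \<open>q\<close>. Otherwise Z
  on \<open>q\<close> is the intermediate string, extended to another qubit if the given string is
  trivial at \<open>q\<close>. The sign hypothesis expresses that the string is not the
  identity.\<close>

lemma transport_to_X:
  assumes p: "supp A p p'" and nonzero: "csign p p' r r' = - 1"
  obtains T where "undoable A 2 T" "intertwines T p p' (single q) none"
proof -
  note result = that
  have two: thesis if s: "supp A s s'" "csign p p' s s' = - 1" "csign s s' (single q) none = - 1" for s s'
  proof (rule undoable_transport2[OF p s(1) supp_q(1) s(2,3)])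
    fix T assume "undoable A 2 T" "intertwines T p p' (single q) none"
    then show thesis by (rule result)
  qed
  consider "p' q" | "\<not> p' q" "p q" | "\<not> p' q" "\<not> p q" by blast
  then show thesis
  proof cases
    case 1
    then have px: "csign p p' (single q) none = - 1" by (simp add: csign_def)
    show thesis
    proof (rule undoable_transport[OF p supp_q(1) px])
      fix T assume "undoable A 1 T" "intertwines T p p' (single q) none"
      then show thesis using undoable_mono[of A 1 T 2] result by simp
    qed
  next
    case 2
    show thesis
      by (rule two[OF supp_q(2)]) (use 2 in \<open>simp_all add: csign_def single_apply\<close>)
  next
    case 3
    have "\<exists>j. p j \<or> p' j"
    proof (rule ccontr)
      assume "\<nexists>j. p j \<or> p' j"
      then have "p = none" "p' = none" by auto
      then show False using nonzero by (simp add: csign_def)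
    qed
    \<comment> \<open>At \<open>j\<close> the intermediate string carries Z if the given one
      contains X there, and X if it is Z there; this makes the two anticommute.\<close>
    then obtain j where j: "p j \<or> p' j" by blast
    then have "j \<in> A" "j \<noteq> q" using p 3 by (auto simp: supp_def)
    then have supp_j: "supp A (single j) none" "supp A none (single j)" and jq: "\<not> single j q"
      by (auto simp: supp_def single_def)
    show thesis
    proof (cases "p j")
      case True
      have "supp A none (single q \<oplus> single j)"
        using supp_bxor[OF supp_q(2) supp_j(2)] by simp
      moreover have "csign p p' none (single q \<oplus> single j) = - 1"
        using True 3 by (simp add: csign_def chi_bxor_left)
      moreover have "csign none (single q \<oplus> single j) (single q) none = - 1"
        using jq by (simp add: csign_def single_apply bxor_def)
      ultimately show thesis by (rule two)
    next
      case False
      have "supp A (single j) (single q)"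
        using supp_bxor[OF supp_q(2) supp_j(1)] by simp
      then show thesis
        by (rule two) (use False j 3 in \<open>simp_all add: csign_def single_apply\<close>)
    qed
  qed
qed

text \<open>All strings on the way, including Y on \<open>q\<close> as intermediate when
  \<open>p q\<close> fails, anticommute with X on \<open>q\<close>; hence the rotations commute with
  X on \<open>q\<close>.\<close>

lemma transport_to_Z:
  assumes p: "supp A p p'" "p' q"
  obtains T where "undoable A 2 T" "intertwines T p p' none (single q)" "commutes T (single q) none"
proof -
  have q': "single q q" by (simp add: single_def)
  have px: "csign p p' (single q) none = - 1" using p(2) by (simp add: csign_def)
  show thesis
  proof (cases "p q")
    case True
    then have pz: "csign p p' none (single q) = - 1" by (simp add: csign_def)
    have eq: "csign p p' (single q) none = csign none (single q) (single q) none"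
      unfolding px by (simp add: csign_def q')
    obtain T where T: "undoable A 1 T" "intertwines T p p' none (single q)"
      "\<And>u w. csign p p' u w = csign none (single q) u w \<Longrightarrow> commutes T u w"
      using undoable_transport[OF p(1) supp_q(2) pz] by blast
    show thesis using undoable_mono[OF T(1), of 2] T(2) T(3)[OF eq] that by simp
  next
    case False
    have eq: "csign p p' (single q) (single q) = - 1"
      "csign (single q) (single q) none (single q) = - 1"
      "csign p p' (single q) none = csign (single q) (single q) (single q) none"
      "csign (single q) (single q) (single q) none = csign none (single q) (single q) none"
      using False p(2) q' by (simp_all add: csign_def)
    obtain T where T: "undoable A 2 T" "intertwines T p p' none (single q)"
      "\<And>u w. csign p p' u w = csign (single q) (single q) u w \<Longrightarrow>
        csign (single q) (single q) u w = csign none (single q) u w \<Longrightarrow> commutes T u w"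
      using undoable_transport2[OF p(1) supp_q(3) supp_q(2) eq(1,2)] by blast
    show thesis using T(1,2) T(3)[OF eq(3,4)] that by simp
  qed
qed

text \<open>A string squaring to 1 can only be conjugated to plus or minus itself. In the minus case
  an anticommuting Pauli corrects the sign, and it affects other strings by signs only.\<close>

lemma fix_sign:
  assumes "normalizes U" "intertwines U s t s t" "chi t s = 1"
    and "csign x y s t = - 1" "realizable 0 (pauli x y)" "supp A x y"
  obtains P where "undoable A 0 P" "commutes (P ** U) s t"
    "\<And>u w. commutes U u w \<Longrightarrow> csign x y u w = 1 \<Longrightarrow> commutes (P ** U) u w"
    "\<And>u w. intertwines U u w u w \<Longrightarrow> intertwines (P ** U) u w u w"
proof -
  obtain c where c: "U ** pauli s t = cscale c (pauli s t ** U)"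
    using assms(2) by (auto simp: intertwines_def)
  have "cscale 1 (mat 1) ** U = U ** pauli s t ** pauli s t"
    using assms(3) by (simp add: pauli_square flip: matrix_mul_assoc)
  also have "\<dots> = cscale c (pauli s t ** U) ** pauli s t"
    by (simp only: c)
  also have "\<dots> = cscale c (pauli s t ** (U ** pauli s t))"
    by (simp only: cscale_mult_left matrix_mul_assoc)
  also have "\<dots> = cscale (c * c) (pauli s t ** pauli s t) ** U"
    unfolding c by (simp add: matrix_mul_assoc)
  also have "\<dots> = cscale (c * c) (mat 1) ** U"
    using assms(3) by (simp add: pauli_square)
  finally have "cscale 1 (mat 1) = cscale (c * c) (mat 1 :: 'q qop)"
    using unit_det_cancel assms(1) unfolding normalizes_def by blast
  then have "1 = c * c" unfolding pauli_none[symmetric] by (rule pauli_inject_scale)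
  then consider "c = 1" | "c = - 1" using square_eq_1_iff[of c] by auto
  then show thesis
  proof cases
    case 1
    have "undoable A 0 (mat 1)"
      using undoable_pauli[of A none none] by (simp add: supp_def realizable_mat_1)
    moreover have "commutes (mat 1 ** U) s t" using c 1 by (simp add: commutes_def)
    ultimately show thesis using that[of "mat 1"] by simp
  next
    case 2
    let ?P = "pauli x y"
    have "commutes (?P ** U) s t"
    proof -
      have "(?P ** U) ** pauli s t = cscale (- 1) (?P ** pauli s t) ** U"
        by (simp add: c 2 flip: matrix_mul_assoc)
      also have "\<dots> = pauli s t ** (?P ** U)"
        using pauli_commute[of x y s t] assms(4) by (simp add: matrix_mul_assoc)
      finally show ?thesis by (simp add: commutes_def)
    qed
    moreover have "commutes (?P ** U) u w" if "commutes U u w" "csign x y u w = 1" for u w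
      using commutes_mult[OF _ that(1)] pauli_commute[of x y u w] that(2) by (simp add: commutes_def)
    moreover have "intertwines (?P ** U) u w u w" if "intertwines U u w u w" for u w
      using that intertwines_pauli by (rule intertwines_mult)
    ultimately show thesis using that undoable_pauli[OF assms(6,5)] by blast
  qed
qed

lemma reduce_qubit:
  assumes U: "fixes_outside A U"
  obtains T where "undoable A 4 T" "fixes_outside (A - {q}) (T ** U)"
proof -
  have qq: "single q q" by (simp add: single_def)
  have norm: "normalizes V" "unit_det V" if "fixes_outside A V" for V
    using that by (simp_all add: fixes_outside_def normalizes_def)
  obtain p p' where p: "intertwines U (single q) none p p'"
    using norm(1)[OF U] unfolding normalizes_def by blast
  obtain r r' where r: "intertwines U none (single q) r r'"
    using norm(1)[OF U] unfolding normalizes_def by blast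
  have XZ: "csign (single q) none none (single q) = - 1"
    by (simp add: csign_def qq)
  have "csign p p' r r' = - 1"
    using intertwines_csign[OF norm(2)[OF U] p r] XZ by simp
  then obtain T where T: "undoable A 2 T" "intertwines T p p' (single q) none"
    using transport_to_X supp_image[OF U p supp_q(1)] by blast
  let ?U1 = "T ** U"
  have U1: "fixes_outside A ?U1" "intertwines ?U1 (single q) none (single q) none"
    using T(1) U intertwines_mult[OF p T(2)] by (simp_all add: undoable_def fixes_outside_mult)
  obtain z z' where z: "intertwines ?U1 none (single q) z z'"
    using norm(1)[OF U1(1)] unfolding normalizes_def by blast
  have "csign (single q) none z z' = - 1"
    using intertwines_csign[OF norm(2)[OF U1(1)] U1(2) z] XZ by simp
  \<comment> \<open>Anticommuting with X on \<open>q\<close> means containing Z there, as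
    \<open>transport_to_Z\<close> requires.\<close>
  then have "z' q" by (auto simp: csign_def sg_def split: if_splits)
  then obtain T' where T': "undoable A 2 T'" "intertwines T' z z' none (single q)" "commutes T' (single q) none"
    using transport_to_Z supp_image[OF U1(1) z supp_q(2)] by blast
  let ?U2 = "T' ** ?U1"
  have U2: "fixes_outside A ?U2"
    using T'(1) U1(1) by (simp add: undoable_def fixes_outside_mult)
  have U2_X: "intertwines ?U2 (single q) none (single q) none"
    by (rule intertwines_mult[OF U1(2) commutes_intertwines[OF T'(3)]])
  have U2_Z: "intertwines ?U2 none (single q) none (single q)"
    by (rule intertwines_mult[OF z T'(2)])
  have ZX: "csign none (single q) (single q) none = - 1" "csign (single q) none (single q) none = 1"
    by (simp_all add: csign_def qq)
  \<comment> \<open>Z on \<open>q\<close> corrects the sign of X; afterwards X on \<open>q\<close>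
    corrects the sign of Z and commutes with X, so the first correction survives.\<close>
  obtain P where P: "undoable A 0 P" "commutes (P ** ?U2) (single q) none"
    "\<And>u w. commutes ?U2 u w \<Longrightarrow> csign none (single q) u w = 1 \<Longrightarrow> commutes (P ** ?U2) u w"
    "\<And>u w. intertwines ?U2 u w u w \<Longrightarrow> intertwines (P ** ?U2) u w u w"
    using fix_sign[OF norm(1)[OF U2] U2_X chi_none(2) ZX(1) realizable_pauli_Z supp_q(2)] by blast
  let ?U3 = "P ** ?U2"
  have U3: "fixes_outside A ?U3"
    using P(1) U2 by (simp add: undoable_def fixes_outside_mult)
  obtain P' where P': "undoable A 0 P'" "commutes (P' ** ?U3) none (single q)"
    "\<And>u w. commutes ?U3 u w \<Longrightarrow> csign (single q) none u w = 1 \<Longrightarrow> commutes (P' ** ?U3) u w"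
    "\<And>u w. intertwines ?U3 u w u w \<Longrightarrow> intertwines (P' ** ?U3) u w u w"
    using fix_sign[OF norm(1)[OF U3] P(4)[OF U2_Z] chi_none(1) XZ realizable_pauli_X supp_q(1)] by blast
  let ?U4 = "P' ** ?U3"
  have U4: "fixes_outside A ?U4"
    using P'(1) U3 by (simp add: undoable_def fixes_outside_mult)
  \<comment> \<open>Such a string is a product of a string off \<open>A\<close> and possibly X and Z
    on \<open>q\<close>, up to sign.\<close>
  have "commutes ?U4 x y" if s: "supp (- (A - {q})) x y" for x y
  proof -
    have "supp (- A) (x(q := False)) (y(q := False))"
      using s by (auto simp: supp_def)
    then have "commutes ?U4 (x(q := False)) (y(q := False))"
      using U4 by (simp add: fixes_outside_def)
    moreover have "commutes ?U4 (if x q then single q else none) none"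
      using P'(3)[OF P(2) ZX(2)] by (simp add: commutes_none)
    moreover have "commutes ?U4 none (if y q then single q else none)"
      using P'(2) by (simp add: commutes_none)
    ultimately have "commutes ?U4 (x(q := False) \<oplus> ((if x q then single q else none) \<oplus> none))
        (y(q := False) \<oplus> (none \<oplus> (if y q then single q else none)))"
      by (intro commutes_bxor)
    moreover have "x(q := False) \<oplus> ((if x q then single q else none) \<oplus> none) = x"
      "y(q := False) \<oplus> (none \<oplus> (if y q then single q else none)) = y"
      by (auto simp: bxor_def single_def fun_eq_iff)
    ultimately show ?thesis by simp
  qed
  then have "fixes_outside (A - {q}) ?U4"
    using norm(1)[OF U4] by (simp add: fixes_outside_def)
  moreover have "?U4 = (P' ** P ** T' ** T) ** U"
    by (simp only: matrix_mul_assoc)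
  moreover have "undoable A 4 (P' ** P ** T' ** T)"
    using undoable_mult[OF undoable_mult[OF undoable_mult[OF P'(1) P(1)] T'(1)] T(1)]
    by (simp add: eval_nat_numeral)
  ultimately show thesis using that by metis
qed

end

text \<open>Truncated subtraction makes the bound 0 for one qubit as well as for none: on a single
  qubit every rotation used is local.\<close>

lemma realizable_of_fixes_outside:
  assumes rot_cost: "\<And>A e a b. supp A a b \<Longrightarrow> e * e * chi b a = - 1 \<Longrightarrow> A \<noteq> {} \<Longrightarrow>
      realizable (if card A \<le> 1 then 0 else 1) (rot e a b :: 'q::finite qop)"
  shows "fixes_outside A (U :: 'q qop) \<Longrightarrow> realizable (4 * (card A - 1)) U"
proof (induction "card A" arbitrary: A U)
  case 0
  then show ?case using realizable_scalar by simp
next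
  case (Suc n)
  then obtain q where q: "q \<in> A" by (metis card.empty ex_in_conv nat.distinct(1))
  have "realizable (if card A \<le> 1 then 0 else 1) (rot e a b :: 'q qop)"
    if "supp A a b" "e * e * chi b a = - 1" for e a b
    using rot_cost[OF that] q by blast
  then obtain T where T: "undoable A 4 T" "fixes_outside (A - {q}) (T ** U)"
    using reduce_qubit[OF q _ Suc.prems] by blast
  obtain T' where T': "T' ** T = mat 1" "realizable (if card A \<le> 1 then 0 else 4) T'"
    using T(1) by (auto simp only: undoable_def)
  have n: "n = card (A - {q})" using Suc.hyps(2) q by simp
  have "realizable ((if card A \<le> 1 then 0 else 4) + 4 * (card (A - {q}) - 1)) (T' ** (T ** U))"
    by (rule realizable_mult[OF T'(2) Suc.hyps(1)[OF n T(2)]])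
  moreover have "T' ** (T ** U) = U" using T'(1) by (simp add: matrix_mul_assoc)
  moreover have "(if card A \<le> 1 then 0 else 4) + 4 * (card (A - {q}) - 1) = 4 * (card A - 1)"
    using n Suc.hyps(2) by auto
  ultimately show ?case by metis
qed

section \<open>The gate GMS as a Pauli rotation\<close>

lemma scaleR_eq_cscale: "r *\<^sub>R A = cscale (complex_of_real r) A"
proof -
  have "(r *\<^sub>R A) $ u $ v = cscale (complex_of_real r) A $ u $ v" for u v
    unfolding vector_scaleR_component cscale_nth by (rule scaleR_conv_of_real)
  then show ?thesis by (simp add: vec_eq_iff)
qed

lemma diagm_exp_sums:
  "(\<lambda>k. (1 / fact k) *\<^sub>R diagm (\<lambda>u. d u ^ k)) sums diagm (\<lambda>u. exp (d u))"
  unfolding sums_def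
proof (intro vec_tendstoI)
  fix u v
  have "(\<lambda>n. \<Sum>k<n. ((1 / fact k) *\<^sub>R diagm (\<lambda>u. d u ^ k)) $ u $ v) \<longlonglongrightarrow> diagm (\<lambda>u. exp (d u)) $ u $ v"
    using exp_converges[of "d u"] unfolding sums_def
    by (cases "u = v") (simp_all add: diagm_nth divide_inverse)
  then show "(\<lambda>n. (\<Sum>k<n. (1 / fact k) *\<^sub>R diagm (\<lambda>u. d u ^ k)) $ u $ v) \<longlonglongrightarrow> diagm (\<lambda>u. exp (d u)) $ u $ v"
    by (simp only: sum_component)
qed

lemma linear_conj: "linear (\<lambda>M. (G :: 'b::finite cmat) ** M ** (G' :: 'b cmat))"
  by (rule linearI) (simp_all add: matrix_add_ldistrib matrix_add_rdistrib scaleR_eq_cscale)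

text \<open>Conjugation commutes with powers and, being a bounded linear map, with the exponential
  series.\<close>

lemma cmat_exp_conj_diagm:
  fixes G G' :: "'b::finite cmat"
  assumes "G' ** G = mat 1" "G ** G' = mat 1"
  shows "cmat_exp (G ** diagm d ** G') = G ** diagm (\<lambda>u. exp (d u)) ** G'"
proof -
  have power: "((**) (G ** diagm d ** G') ^^ k) (mat 1) = G ** diagm (\<lambda>u. d u ^ k) ** G'" for k
  proof (induction k)
    case 0
    then show ?case by (simp add: diagm_one assms)
  next
    case (Suc k)
    have "(G ** diagm d ** G') ** (G ** diagm (\<lambda>u. d u ^ k) ** G')
        = G ** diagm d ** (G' ** G) ** diagm (\<lambda>u. d u ^ k) ** G'"
      by (simp only: matrix_mul_assoc)
    also have "\<dots> = G ** (diagm d ** diagm (\<lambda>u. d u ^ k)) ** G'"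
      by (simp only: assms matrix_mul_rid matrix_mul_assoc)
    finally show ?case by (simp only: funpow.simps comp_apply Suc diagm_mult power_Suc)
  qed
  have "bounded_linear (\<lambda>M. G ** M ** G')"
    using linear_conj[of G G'] by (simp only: linear_conv_bounded_linear)
  from bounded_linear.sums[OF this diagm_exp_sums]
  have "(\<lambda>k. (1 / fact k) *\<^sub>R (G ** diagm (\<lambda>u. d u ^ k) ** G')) sums (G ** diagm (\<lambda>u. exp (d u)) ** G')"
    by (simp only: scaleR_eq_cscale cscale_mult_left cscale_mult_right)
  then show ?thesis
    unfolding cmat_exp_def power by (rule sums_unique[symmetric])
qed

text \<open>\<open>G\<close> is a Hadamard gate on every qubit, used only through its action on
  single Z operators.\<close>

lemma hadamard_layer:
  obtains G G' :: "'q::finite qop" where "G' ** G = mat 1" "G ** G' = mat 1" "realizable 0 G" "realizable 0 G'"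
    "\<And>j. G ** pauli none (single j) = pauli (single j) none ** G"
proof -
  \<comment> \<open>Induction over the set \<open>B\<close> of qubits that have already received
    their Hadamard gate.\<close>
  have "\<exists>G G' :: 'q qop. G' ** G = mat 1 \<and> G ** G' = mat 1 \<and> realizable 0 G \<and> realizable 0 G' \<and>
    (\<forall>j. G ** pauli none (single j) = (if j \<in> B then pauli (single j) none else pauli none (single j)) ** G)"
    if "finite B" for B
    using that
  proof (induction B)
    case empty
    show ?case by (intro exI[of _ "mat 1"]) (simp add: realizable_mat_1)
  next
    case (insert q B)
    then obtain G G' :: "'q qop" where G: "G' ** G = mat 1" "G ** G' = mat 1" "realizable 0 G" "realizable 0 G'"
      and conj: "\<And>j. G ** pauli none (single j)
          = (if j \<in> B then pauli (single j) none else pauli none (single j)) ** G"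
      by blast
    let ?H = "on_qubit q hadamard"
    have other: "?H ** pauli (single j) none = pauli (single j) none ** ?H"
      "?H ** pauli none (single j) = pauli none (single j) ** ?H" if "j \<noteq> q" for j
    proof -
      have "\<not> single j q" "(single j)(q := False) = single j" "none(q := False) = none"
        using that by (auto simp: single_def fun_eq_iff)
      then show "?H ** pauli (single j) none = pauli (single j) none ** ?H"
        "?H ** pauli none (single j) = pauli none (single j) ** ?H"
        using hadamard_pauli[of q "single j" none] hadamard_pauli[of q none "single j"] by simp_all
    qed
    have "(?H ** G) ** pauli none (single j)
        = (if j \<in> insert q B then pauli (single j) none else pauli none (single j)) ** (?H ** G)" for j
    proof -
      have "(?H ** G) ** pauli none (single j)
          = (?H ** (if j \<in> B then pauli (single j) none else pauli none (single j))) ** G"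
        by (simp only: conj flip: matrix_mul_assoc)
      also have "?H ** (if j \<in> B then pauli (single j) none else pauli none (single j))
          = (if j \<in> insert q B then pauli (single j) none else pauli none (single j)) ** ?H"
        using other hadamard_pauli_Z[of q] insert.hyps(2) by (cases "j = q") auto
      finally show ?thesis by (simp only: matrix_mul_assoc)
    qed
    moreover have "(G' ** ?H) ** (?H ** G) = G' ** (?H ** ?H) ** G" "(?H ** G) ** (G' ** ?H) = ?H ** (G ** G') ** ?H"
      by (simp_all only: matrix_mul_assoc)
    then have "(G' ** ?H) ** (?H ** G) = mat 1" "(?H ** G) ** (G' ** ?H) = mat 1"
      by (simp_all add: G hadamard_inverse)
    moreover have "realizable 0 (?H ** G)" "realizable 0 (G' ** ?H)"
      by (intro realizable_mult_local G realizable_hadamard)+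
    ultimately show ?case by blast
  qed
  from this[OF finite_class.finite_UNIV] show thesis using that by auto
qed

lemma pauli_X_on_qubit: "on_qubit q pauli_X = pauli (single q) none"
proof -
  have "on_qubit q pauli_X $ u $ v = pauli (single q) none $ u $ v" for u v
    by (auto simp: on_qubit_def pauli_X_def pauli_def bxor_def single_def fun_eq_iff)
  then show ?thesis by (simp add: vec_eq_iff)
qed

lemma sum_distinct_pairs:
  fixes z :: "'a::finite \<Rightarrow> 'b::comm_ring_1"
  shows "(\<Sum>(i, j) \<in> {(i, j). i \<in> S \<and> j \<in> S \<and> i \<noteq> j}. z i * z j) = (\<Sum>i\<in>S. z i)\<^sup>2 - (\<Sum>i\<in>S. z i * z i)"
proof -
  have "(\<Sum>i\<in>S. z i)\<^sup>2 = (\<Sum>(i, j)\<in>S \<times> S. z i * z j)"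
    by (simp add: power2_eq_square sum_product sum.cartesian_product)
  also have "S \<times> S = {(i, j). i \<in> S \<and> j \<in> S \<and> i \<noteq> j} \<union> (\<lambda>i. (i, i)) ` S"
    by auto
  also have "(\<Sum>(i, j)\<in>\<dots>. z i * z j) = (\<Sum>(i, j) \<in> {(i, j). i \<in> S \<and> j \<in> S \<and> i \<noteq> j}. z i * z j)
      + (\<Sum>(i, j)\<in>(\<lambda>i. (i, i)) ` S. z i * z j)"
    by (rule sum.union_disjoint) auto
  also have "(\<Sum>(i, j)\<in>(\<lambda>i. (i, i)) ` S. z i * z j) = (\<Sum>i\<in>S. z i * z i)"
    by (subst sum.reindex) (auto simp: inj_on_def)
  finally show ?thesis by simp
qed

text \<open>The Hadamard layer turns XX into ZZ. Summed over ordered pairs the ZZ eigenvalues give a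
  full square minus its diagonal, and each diagonal term is 1.\<close>

lemma gms_conj_diagm:
  fixes G G' :: "'q::finite qop"
  assumes "G' ** G = mat 1" "G ** G' = mat 1"
    and X: "\<And>j. G ** pauli none (single j) = pauli (single j) none ** G"
  shows "gms S \<alpha> = G ** diagm (\<lambda>u. exp (- \<i> * complex_of_real \<alpha> / 4 *
    ((\<Sum>i\<in>S. sg (u i))\<^sup>2 - of_nat (card S)))) ** G'"
proof -
  let ?D = "{(i, j). i \<in> S \<and> j \<in> S \<and> i \<noteq> j}" and ?c = "- \<i> * complex_of_real \<alpha> / 4"
  let ?Z = "\<lambda>(i, j). pauli none (single i) ** pauli none (single j)"
  have XX: "on_qubit i pauli_X ** on_qubit j pauli_X = G ** ?Z (i, j) ** G'" for i j
  proof -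
    have "G ** ?Z (i, j) ** G' = (G ** pauli none (single i)) ** pauli none (single j) ** G'"
      by (simp only: prod.case matrix_mul_assoc)
    also have "\<dots> = pauli (single i) none ** (G ** pauli none (single j)) ** G'"
      unfolding X[of i] by (simp only: matrix_mul_assoc)
    also have "\<dots> = pauli (single i) none ** pauli (single j) none ** (G ** G')"
      unfolding X[of j] by (simp only: matrix_mul_assoc)
    finally show ?thesis by (simp add: assms pauli_X_on_qubit)
  qed
  have ZZ: "(\<Sum>p\<in>?D. ?Z p) = diagm (\<lambda>u. (\<Sum>i\<in>S. sg (u i))\<^sup>2 - of_nat (card S))"
  proof -
    have "(\<Sum>p\<in>?D. ?Z p) $ u $ v = diagm (\<lambda>u. (\<Sum>(i, j)\<in>?D. sg (u i) * sg (u j))) $ u $ v" for u v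
      by (simp add: pauli_Z_diagm diagm_mult sum_component case_prod_unfold diagm_nth)
    moreover have "sg s * sg s = 1" for s by (simp add: sg_def)
    ultimately show ?thesis by (simp add: vec_eq_iff sum_distinct_pairs)
  qed
  have "(\<Sum>(i, j)\<in>?D. on_qubit i pauli_X ** on_qubit j pauli_X) = (\<Sum>p\<in>?D. G ** ?Z p ** G')"
    by (rule sum.cong) (auto simp: XX)
  also have "\<dots> = G ** (\<Sum>p\<in>?D. ?Z p) ** G'"
    using linear_sum[OF linear_conj[of G G'], of ?Z ?D] by simp
  finally have sum: "(\<Sum>(i, j)\<in>?D. on_qubit i pauli_X ** on_qubit j pauli_X)
      = G ** diagm (\<lambda>u. (\<Sum>i\<in>S. sg (u i))\<^sup>2 - of_nat (card S)) ** G'"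
    by (simp only: ZZ)
  have scale: "cscale c (G ** diagm d ** G') = G ** diagm (\<lambda>u. c * d u) ** G'" for c d
    by (simp only: cscale_mult_left cscale_mult_right flip: cscale_diagm)
  show ?thesis
    unfolding gms_def sum scale by (rule cmat_exp_conj_diagm[OF assms(1,2)])
qed

lemma realizable_phase_power_prod:
  "realizable 0 (diagm (\<lambda>u. \<i> ^ (k * card {j\<in>S. u j})) :: 'q::finite qop)"
proof -
  have "realizable 0 (diagm (\<lambda>u. \<i> ^ (k * card {j\<in>S. u j})) :: 'q qop)" if "finite S" for S
    using that
  proof (induction S)
    case empty
    then show ?case by (simp add: diagm_one realizable_mat_1)
  next
    case (insert q S)
    have card: "card {j \<in> insert q S. u j} = (if u q then 1 else 0) + card {j \<in> S. u j}" for u :: "'q \<Rightarrow> bool"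
    proof -
      have "{j \<in> insert q S. u j} = (if u q then insert q {j \<in> S. u j} else {j \<in> S. u j})" by auto
      then show ?thesis using insert.hyps by simp
    qed
    have "\<i> ^ (k * card {j \<in> insert q S. u j}) = (if u q then \<i> ^ k else 1) * \<i> ^ (k * card {j\<in>S. u j})"
      for u :: "'q \<Rightarrow> bool"
      unfolding card by (simp add: power_add distrib_left)
    then have "diagm (\<lambda>u. \<i> ^ (k * card {j \<in> insert q S. u j}))
        = diagm (\<lambda>u. if u q then \<i> ^ k else 1) ** (diagm (\<lambda>u. \<i> ^ (k * card {j\<in>S. u j})) :: 'q qop)"
      by (simp only: diagm_mult)
    then show ?case
      using realizable_mult_local(1)[OF realizable_phase_power insert.IH] by (simp only:)
  qed
  then show ?thesis by simp
qed

lemma sum_sg: "(\<Sum>i\<in>S. sg (u i)) = of_nat (card S) - 2 * of_nat (card {j\<in>S. u j})"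
  if "finite S"
  using that
proof (induction S)
  case (insert q S)
  have "{j \<in> insert q S. u j} = (if u q then insert q {j \<in> S. u j} else {j \<in> S. u j})" by auto
  then show ?case using insert by (simp add: sg_def)
qed simp

lemma chi_card: "chi b u = (- 1) ^ card {j. b j \<and> u j}"
  by (simp add: chi_def sg_def prod.If_cases Int_def)

text \<open>
  With \<open>m = card S\<close> and \<open>w = card {j\<in>S. u j}\<close> the exponent of the gate with
  angle \<open>\<plusminus> \<pi> / 2\<close> is \<open>\<mp> \<i> \<pi> / 8 ((m - 2 w)\<^sup>2 - m)\<close>; up to a constant, its exponential
  consists of \<open>(\<minusplus> \<i>) ^ (w\<^sup>2)\<close>, which only depends on the parity of \<open>w\<close>, and of
  \<open>(\<plusminus> \<i>) ^ (m w)\<close>, which phase gates on the single qubits cancel.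
\<close>

lemma gms_eigenvalue:
  fixes e :: complex and m w :: nat
  assumes e: "e = \<i> \<and> \<alpha> = pi / 2 \<or> e = - \<i> \<and> \<alpha> = - pi / 2"
  shows "exp (- \<i> * complex_of_real \<alpha> / 4 * ((of_nat m - 2 * of_nat w)\<^sup>2 - of_nat m))
    = exp (- \<i> * complex_of_real \<alpha> / 4 * ((of_nat m)\<^sup>2 - of_nat m)) * (e ^ (m * w) * (if even w then 1 else - e))"
proof -
  have exp_e: "exp (\<i> * complex_of_real \<alpha>) = e"
    unfolding cis_conv_exp[symmetric] using e
    by (elim disjE conjE; hypsubst) (simp_all add: complex_eq_iff)
  have "e * - e = 1" using e by auto
  then have exp_minus_e: "exp (- (\<i> * complex_of_real \<alpha>)) = - e"
    unfolding exp_minus exp_e by (metis inverse_unique)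
  \<comment> \<open>Expanding the square leaves - 4 m w + 4 w^2 beside the constant part, and the
    factor 4 cancels the denominator.\<close>
  have "exp (- \<i> * complex_of_real \<alpha> / 4 * ((of_nat m - 2 * of_nat w)\<^sup>2 - of_nat m))
      = exp (- \<i> * complex_of_real \<alpha> / 4 * ((of_nat m)\<^sup>2 - of_nat m)
          + (of_nat (m * w) * (\<i> * complex_of_real \<alpha>) + of_nat (w * w) * (- (\<i> * complex_of_real \<alpha>))))"
    by (rule arg_cong[of _ _ exp]) (simp add: field_simps power2_eq_square)
  also have "\<dots> = exp (- \<i> * complex_of_real \<alpha> / 4 * ((of_nat m)\<^sup>2 - of_nat m)) * (e ^ (m * w) * (- e) ^ (w * w))"
    by (simp only: exp_add exp_of_nat_mult exp_e exp_minus_e)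
  also have "(- e) ^ (w * w) = (if even w then 1 else - e)"
  proof -
    \<comment> \<open>The square of \<open>w\<close> is 0 or 1 modulo 4 according to parity.\<close>
    have e4: "(- e) ^ 4 = 1" using e by (auto simp: eval_nat_numeral)
    show ?thesis
    proof (cases "even w")
      case True
      then obtain v where "w = 2 * v" by blast
      then have "w * w = 4 * (v * v)" by simp
      then show ?thesis using True by (simp only: power_mult e4) simp
    next
      case False
      then obtain v where "w = 2 * v + 1" using oddE by blast
      then have "w * w = 4 * (v * v + v) + 1" by (simp add: algebra_simps)
      then show ?thesis using False by (simp only: power_add power_mult e4) simp
    qed
  qed
  finally show ?thesis .
qed

lemma realizable_rot_Z:
  assumes "e * e = - 1"
  shows "realizable 1 (rot e none (b :: 'q::finite \<Rightarrow> bool))"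
proof -
  obtain G G' :: "'q qop" where G: "G' ** G = mat 1" "G ** G' = mat 1" "realizable 0 G" "realizable 0 G'"
    and X: "\<And>j. G ** pauli none (single j) = pauli (single j) none ** G"
    using hadamard_layer by metis
  define S m where "S = {j. b j}" and "m = card S"
  obtain \<alpha> where \<alpha>: "e = \<i> \<and> \<alpha> = pi / 2 \<or> e = - \<i> \<and> \<alpha> = - pi / 2"
    using imaginary_unit_cases[OF assms] by blast
  \<comment> \<open>\<open>\<i> ^ l\<close> is the inverse of \<open>e\<close>, so the local layer
    \<open>?P\<close> with exponent \<open>l * m\<close> cancels the factor
    \<open>e ^ (m * w)\<close>.\<close>
  obtain l where l: "\<i> ^ l * e = 1"
  proof -
    have "\<i> ^ 3 * \<i> = 1" by (simp add: eval_nat_numeral)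
    then show thesis using that[of 3] that[of 1] imaginary_unit_cases[OF assms] by auto
  qed
  define c where "c = exp (- \<i> * complex_of_real \<alpha> / 4 * ((of_nat m)\<^sup>2 - of_nat m))"
  let ?P = "diagm (\<lambda>u. \<i> ^ (l * m * card {j\<in>S. u j})) :: 'q qop"
  let ?d = "\<lambda>u :: 'q \<Rightarrow> bool. if chi b u = 1 then 1 else - e"
  define D where "D = diagm (\<lambda>u. exp (- \<i> * complex_of_real \<alpha> / 4 *
    ((\<Sum>i\<in>S. sg (u i))\<^sup>2 - of_nat (card S))) :: complex)"
  have "D ** ?P = cscale c (diagm ?d)"
  proof -
    have "exp (- \<i> * complex_of_real \<alpha> / 4 * ((\<Sum>i\<in>S. sg (u i))\<^sup>2 - of_nat (card S)))
        * \<i> ^ (l * m * card {j\<in>S. u j}) = c * ?d u" for u :: "'q \<Rightarrow> bool"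
    proof -
      define w where "w = card {j\<in>S. u j}"
      have "chi b u = (- 1) ^ w" by (simp add: chi_card w_def S_def)
      then have d: "?d u = (if even w then 1 else - e)" by simp
      have "e ^ (m * w) * \<i> ^ (l * m * w) = (\<i> ^ l * e) ^ (m * w)"
        by (simp add: power_mult_distrib flip: power_mult mult.assoc)
      then have cancel: "e ^ (m * w) * \<i> ^ (l * m * w) = 1" by (simp add: l)
      have "exp (- \<i> * complex_of_real \<alpha> / 4 * ((\<Sum>i\<in>S. sg (u i))\<^sup>2 - of_nat (card S)))
        = c * (e ^ (m * w) * ?d u)"
        unfolding sum_sg[OF finite] d c_def using gms_eigenvalue[OF \<alpha>, of m w] by (simp only: m_def w_def)
      then have "exp (- \<i> * complex_of_real \<alpha> / 4 * ((\<Sum>i\<in>S. sg (u i))\<^sup>2 - of_nat (card S))) * \<i> ^ (l * m * w)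
        = c * ?d u * (e ^ (m * w) * \<i> ^ (l * m * w))"
        by (simp only: mult_ac)
      then show ?thesis by (simp only: cancel flip: w_def) simp
    qed
    then show ?thesis unfolding D_def diagm_mult cscale_diagm by simp
  qed
  moreover have "realizable 1 (D ** ?P)"
  proof -
    have "gms S \<alpha> = G ** D ** G'"
      unfolding D_def by (rule gms_conj_diagm[OF G(1,2) X])
    then have "G' ** gms S \<alpha> ** G = (G' ** G) ** D ** (G' ** G)"
      by (simp only: matrix_mul_assoc)
    then have "D = G' ** gms S \<alpha> ** G" by (simp add: G)
    then show ?thesis
      by (simp only: realizable_mult_local G realizable_gms realizable_phase_power_prod)
  qed
  moreover have "cmod c = 1"
  proof -
    \<comment> \<open>The exponent is purely imaginary, so \<open>c\<close> is a global
      phase.\<close>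
    have "c = exp (\<i> * complex_of_real (- \<alpha> / 4 * ((real m)\<^sup>2 - real m)))"
      unfolding c_def by (rule arg_cong[of _ _ exp]) (simp add: field_simps)
    then show ?thesis by (simp only: norm_exp_i_times)
  qed
  ultimately have "realizable 1 (cscale c (diagm ?d))" "cmod (inverse c) = 1" "c \<noteq> 0"
    by (auto simp: norm_inverse)
  then have "realizable 1 (diagm ?d)"
    using realizable_cscale[of "inverse c" 1 "cscale c (diagm ?d)"] by simp
  then show ?thesis
    unfolding rot_Z_diagm[OF assms] by (rule realizable_cscale[OF cmod_phase[OF assms]])
qed

lemma realizable_rot:
  assumes "supp A a b" "e * e * chi b a = - 1" "A \<noteq> {}"
  shows "realizable (if card A \<le> 1 then 0 else 1) (rot e a b :: 'q::finite qop)"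
proof (rule realizable_rot_of_Z[where A = A])
  fix b :: "'q \<Rightarrow> bool" and e :: complex
  assume b: "\<And>j. b j \<Longrightarrow> j \<in> A" and e: "e * e = - 1"
  show "realizable (if card A \<le> 1 then 0 else 1) (rot e none b)"
  proof (cases "card A \<le> 1")
    case True
    then have "card A = 1" using assms(3) by (simp add: card_gt_0_iff le_Suc_eq)
    then obtain q where "A = {q}" by (rule card_1_singletonE)
    then have "realizable 0 (rot e none b)"
      using b by (intro realizable_rot_single[OF _ e]) auto
    then show ?thesis using True by simp
  next
    case False
    then show ?thesis using realizable_rot_Z[OF e] by simp
  qed
qed (use assms in \<open>auto simp: supp_def\<close>)

theorem theorem3p2:
  fixes U :: "'q::finite qop"
  assumes "CARD('q) \<ge> 2"
    and "clifford U"
  shows "\<exists>C :: 'q gate list.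
           (\<forall>g \<in> set C. admissible_gate g) \<and>
           eq_up_to_phase U (circuit_op C) \<and>
           gms_count C \<le> 6 * CARD('q) - 8"
proof -
  \<comment> \<open>Outside the full set of qubits only the identity string remains.\<close>
  have "commutes U x y" if "supp (- UNIV) x y" for x y
  proof -
    have "x = none" "y = none" using that by (auto simp: supp_def)
    then show ?thesis by (simp add: commutes_none)
  qed
  then have "fixes_outside UNIV U"
    using normalizes_clifford[OF assms(2)] by (simp add: fixes_outside_def)
  then have "realizable (4 * (CARD('q) - 1)) U"
    using realizable_of_fixes_outside[OF realizable_rot] by blast
  then have "realizable (6 * CARD('q) - 8) U"
    using assms(1) by (elim realizable_mono) linarith
  then show ?thesis by (simp add: realizable_def)
qed

end
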